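(* Let $k$ be a positive integer, let $\mu\in\mathcal{G}_k$, and let $w=(i_1,\dots,i_n)$ be a word in $[k]^*$, where $n\ge2$. The coefficient $(\log\chi_\mu)(Y_w)$ of $z_w$ in the $LS$-transform of $\mu$ can be expressed as $$(\log\chi_\mu)(Y_w)=\sum_{\Gamma\text{ chain in }NC(n)}\frac{(-1)^{1+|\Gamma|}}{|\Gamma|}\,\mathrm{Cf}^{(\Gamma)}_{(i_1,\dots,i_n)}(R_\mu),$$ where $R_\mu$ is the $R$-transform of $\mu$.
   Context: $\mathcal{G}_k$ is the set of linear functionals $\mu:\mathbb{C}\langle X_1,\dots,X_k\rangle\to\mathbb{C}$ (on non-commutative polynomials) with $\mu(1)=1$ and $\mu(X_i)=1$ for $1\le i\le k$. Words and non-crossing partitions. $[k]^*$ is the set of finite words over $\{1,\dots,k\}$, $|w|$ is the length of $w$. For $w=(i_1,\dots,i_n)$ and $B=\{b_1<\dots<b_m\}\subseteq\{1,\dots,n\}$, $w|B:=(i_{b_1},\dots,i_{b_m})$. $NC(n)$ is the lattice of non-crossing partitions of $\{1,\dots,n\}$ ordered by reversed refinement ($\pi\le\rho$ iff every block of $\rho$ is a union of blocks of $\pi$), with minimum $0_n$ (all blocks singletons) and maximum $1_n$ (one block). For $\pi\in NC(n)$, $P_\pi$ is the permutation of $\{1,\dots,n\}$ which maps cyclically $b_1\mapsto b_2\mapsto\cdots\mapsto b_m\mapsto b_1$ on every block $\{b_1<\dots<b_m\}$ of $\pi$. For $\pi\le\rho$ in $NC(n)$ the relative Kreweras complement $K_\rho(\pi)\in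 NC(n)$ is determined by $P_{K_\rho(\pi)}=P_\pi^{-1}P_\rho$ (composition of maps); $K(\pi):=K_{1_n}(\pi)$. A chain in $NC(n)$ is a tuple $\Gamma=(\pi_0,\pi_1,\dots,\pi_\ell)$ with $0_n=\pi_0<\pi_1<\cdots<\pi_\ell=1_n$; its length is $|\Gamma|:=\ell$. Coefficients and $R$-transform. For a power series $f$ with vanishing constant term in non-commuting indeterminates $z_1,\dots,z_k$, $\mathrm{Cf}_w(f)$ is the coefficient of $z_w:=z_{i_1}\cdots z_{i_n}$ in $f$ ($w=(i_1,\dots,i_n)$, $n\ge1$), $\mathrm{Cf}_{w;\pi}(f):=\prod_{B\text{ block of }\pi}\mathrm{Cf}_{w|B}(f)$ for $\pi\in NC(n)$, and for a chain $\Gamma=(\pi_0,\dots,\pi_\ell)$ in $NC(n)$, $\mathrm{Cf}^{(\Gamma)}_w(f):=\prod_{j=1}^{\ell}\mathrm{Cf}_{w;K_{\pi_j}(\pi_{j-1})}(f)$. $R_\mu$ is the unique such series with $\mu(X_{i_1}\cdots X_{i_n})=\sum_{\pi\in NC(n)}\mathrm{Cf}_{(i_1,\dots,i_n);\pi}(R_\mu)$ for all $n\ge1$ and all indices. The Hopf algebra $\mathcal{Y}^{(k)}$. As an algebra, $\mathcal{Y}^{(k)}=\mathbb{C}[Y_w\mid w\in[k]^*,|w|\ge2]$ (commutative polynomials). Put $Y_w:=1$ if $|w|=1$, and $Y_{w;\pi}:=\prod_{A\text{ block of }\pi}Y_{w|A}$ for $|w|=n$, $\pi\in NC(n)$. The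 comultiplication $\Delta$ is the unital algebra homomorphism with $\Delta(Y_w)=\sum_{\pi\in NC(n)}Y_{w;\pi}\otimes Y_{w;K(\pi)}$ for $|w|=n\ge2$, and the counit $\varepsilon$ is the unital algebra homomorphism with $\varepsilon(Y_w)=0$ for $|w|\ge2$. With these, $\mathcal{Y}^{(k)}$ is a graded connected Hopf algebra, $Y_w$ being homogeneous of degree $|w|-1$. The convolution of linear functionals $\xi,\eta$ on $\mathcal{Y}^{(k)}$ is $\xi\eta:=(\xi\otimes\eta)\circ\Delta$. For a linear functional $\eta$ with $\eta(1)=1$, $\log\eta:=-\sum_{\ell=1}^\infty\frac1\ell(\varepsilon-\eta)^\ell$ (convolution powers; on each homogeneous component only finitely many terms are non-zero). For $\mu\in\mathcal{G}_k$, $\chi_\mu:\mathcal{Y}^{(k)}\to\mathbb{C}$ is the unital algebra homomorphism with $\chi_\mu(Y_w)=\mathrm{Cf}_w(R_\mu)$ for all $|w|\ge2$, and the $LS$-transform of $\mu$ is $LS_\mu(z_1,\dots,z_k):=\sum_{|w|\ge2}\big((\log\chi_\mu)(Y_w)\big)z_w$. *)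

theory Defs
  imports
    Complex_Main
    "HOL-Library.Poly_Mapping"
    "HOL-Library.Product_Plus"
    "HOL-Library.Disjoint_Sets"
begin

text \<open>
  The alphabet \<open>{1, \<dots>, k}\<close> is an arbitrary finite type \<open>'k\<close>, and \<open>[k]\<^sup>*\<close> is the type
  \<open>'k list\<close>. All algebras below are monoid algebras over \<open>\<complex>\<close>, that is, types
  \<open>'m \<Rightarrow>\<^sub>0 complex\<close> with \<open>'m\<close> an (additively written) monoid of monomials.
\<close>

section \<open>Linear functionals and algebra homomorphisms\<close>

definition cscale :: "complex \<Rightarrow> ('m \<Rightarrow>\<^sub>0 complex) \<Rightarrow> ('m \<Rightarrow>\<^sub>0 complex)" where
  "cscale c p = Poly_Mapping.map ((*) c) p"

definition linear_functional :: "(('m \<Rightarrow>\<^sub>0 complex) \<Rightarrow> complex) \<Rightarrow> bool" where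
  "linear_functional \<phi> \<longleftrightarrow> Vector_Spaces.linear cscale (*) \<phi>"

definition unital_alg_hom ::
  "(complex \<Rightarrow> 'a \<Rightarrow> 'a) \<Rightarrow> (complex \<Rightarrow> 'b \<Rightarrow> 'b) \<Rightarrow> ('a::ring_1 \<Rightarrow> 'b::ring_1) \<Rightarrow> bool" where
  "unital_alg_hom s1 s2 f \<longleftrightarrow>
     Vector_Spaces.linear s1 s2 f \<and> f 1 = 1 \<and> (\<forall>x y. f (x * y) = f x * f y)"


section \<open>Non-commutative polynomials\<close>

text \<open>A copy of the type of words, carrying the monoid structure of concatenation.\<close>

datatype 'k ncmonom = NCMonom (letters: "'k list")

instantiation ncmonom :: (type) monoid_add
begin

definition zero_ncmonom :: "'a ncmonom" where
  "0 = NCMonom []"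

definition plus_ncmonom :: "'a ncmonom \<Rightarrow> 'a ncmonom \<Rightarrow> 'a ncmonom" where
  "a + b = NCMonom (letters a @ letters b)"

instance
  by intro_classes (simp_all add: zero_ncmonom_def plus_ncmonom_def)

end

type_synonym 'k ncpoly = "'k ncmonom \<Rightarrow>\<^sub>0 complex"

definition ncX :: "'k \<Rightarrow> 'k ncpoly" where
  "ncX i = Poly_Mapping.single (NCMonom [i]) 1"

definition Gk :: "('k ncpoly \<Rightarrow> complex) set" where
  "Gk = {\<mu>. linear_functional \<mu> \<and> \<mu> 1 = 1 \<and> (\<forall>i. \<mu> (ncX i) = 1)}"


section \<open>Non-crossing partitions\<close>

definition noncrossing :: "nat set set \<Rightarrow> bool" where
  "noncrossing \<pi> \<longleftrightarrow>
     (\<forall>A\<in>\<pi>. \<forall>B\<in>\<pi>. A \<noteq> B \<longrightarrow>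
        \<not> (\<exists>a b c d. a < b \<and> b < c \<and> c < d \<and> a \<in> A \<and> c \<in> A \<and> b \<in> B \<and> d \<in> B))"

definition NC :: "nat \<Rightarrow> nat set set set" where
  "NC n = {\<pi>. partition_on {1..n} \<pi> \<and> noncrossing \<pi>}"

definition nc_le :: "nat set set \<Rightarrow> nat set set \<Rightarrow> bool" where
  "nc_le \<pi> \<rho> \<longleftrightarrow> (\<forall>B\<in>\<rho>. \<exists>S\<subseteq>\<pi>. B = \<Union>S)"

definition nc_less :: "nat set set \<Rightarrow> nat set set \<Rightarrow> bool" where
  "nc_less \<pi> \<rho> \<longleftrightarrow> nc_le \<pi> \<rho> \<and> \<pi> \<noteq> \<rho>"

definition nc_zero :: "nat \<Rightarrow> nat set set" where
  "nc_zero n = (\<lambda>i. {i}) ` {1..n}"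

definition nc_one :: "nat \<Rightarrow> nat set set" where
  "nc_one n = {{1..n}}"

definition cyclic_succ :: "nat set \<Rightarrow> nat \<Rightarrow> nat" where
  "cyclic_succ B i = (if \<exists>j\<in>B. i < j then Min {j\<in>B. i < j} else Min B)"

text \<open>The permutation \<open>P\<^sub>\<pi>\<close>, extended by the identity outside of \<open>{1..n}\<close>.\<close>

definition block_perm :: "nat set set \<Rightarrow> nat \<Rightarrow> nat" where
  "block_perm \<pi> i =
     (if i \<in> \<Union>\<pi> then cyclic_succ (THE B. B \<in> \<pi> \<and> i \<in> B) i else i)"

text \<open>\<open>rel_kreweras n \<rho> \<pi>\<close> is \<open>K\<^sub>\<rho>(\<pi>)\<close>, for \<open>\<pi> \<le> \<rho>\<close> in \<open>NC n\<close>.\<close>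

definition rel_kreweras :: "nat \<Rightarrow> nat set set \<Rightarrow> nat set set \<Rightarrow> nat set set" where
  "rel_kreweras n \<rho> \<pi> =
     (THE \<sigma>. \<sigma> \<in> NC n \<and> block_perm \<sigma> = inv (block_perm \<pi>) \<circ> block_perm \<rho>)"

definition kreweras :: "nat \<Rightarrow> nat set set \<Rightarrow> nat set set" where
  "kreweras n \<pi> = rel_kreweras n (nc_one n) \<pi>"

text \<open>A chain \<open>(\<pi>\<^sub>0, \<dots>, \<pi>\<^sub>\<ell>)\<close> is a list with \<open>\<ell> + 1\<close> entries.\<close>

definition nc_chains :: "nat \<Rightarrow> nat set set list set" where
  "nc_chains n =
     {\<Gamma>. \<Gamma> \<noteq> [] \<and> set \<Gamma> \<subseteq> NC n \<and> hd \<Gamma> = nc_zero n \<and> last \<Gamma> = nc_one n \<and>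
          (\<forall>j. Suc j < length \<Gamma> \<longrightarrow> nc_less (\<Gamma> ! j) (\<Gamma> ! Suc j))}"

definition chain_length :: "nat set set list \<Rightarrow> nat" where
  "chain_length \<Gamma> = length \<Gamma> - 1"

text \<open>The word \<open>w|B\<close>; list positions start at 0 whereas \<open>B \<subseteq> {1..length w}\<close>.\<close>

definition restrict_word :: "'k list \<Rightarrow> nat set \<Rightarrow> 'k list" where
  "restrict_word w B = nths w {j. Suc j \<in> B}"


section \<open>Non-commutative power series and the R-transform\<close>

text \<open>A power series in the non-commuting \<open>z\<^sub>i\<close> is the family of its coefficients.\<close>

type_synonym 'k ncps = "'k list \<Rightarrow> complex"

definition Cf :: "'k list \<Rightarrow> 'k ncps \<Rightarrow> complex" where
  "Cf w f = f w"

definition Cf_part :: "'k list \<Rightarrow> nat set set \<Rightarrow> 'k ncps \<Rightarrow> complex" where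
  "Cf_part w \<pi> f = (\<Prod>B\<in>\<pi>. Cf (restrict_word w B) f)"

definition Cf_chain :: "'k list \<Rightarrow> nat set set list \<Rightarrow> 'k ncps \<Rightarrow> complex" where
  "Cf_chain w \<Gamma> f =
     (\<Prod>j=1..chain_length \<Gamma>. Cf_part w (rel_kreweras (length w) (\<Gamma> ! j) (\<Gamma> ! (j - 1))) f)"

definition R_transform :: "('k ncpoly \<Rightarrow> complex) \<Rightarrow> 'k ncps" where
  "R_transform \<mu> =
     (THE f. f [] = 0 \<and>
        (\<forall>w. w \<noteq> [] \<longrightarrow>
           \<mu> (prod_list (map ncX w)) = (\<Sum>\<pi>\<in>NC (length w). Cf_part w \<pi> f)))"


section \<open>The Hopf algebra\<close>

text \<open>Indices of the polynomial generators: words of length at least 2.\<close>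

typedef 'k long_word = "{w :: 'k list. 2 \<le> length w}"
  by (rule exI[of _ "replicate 2 undefined"]) simp

type_synonym 'k ymonom = "'k long_word \<Rightarrow>\<^sub>0 nat"
type_synonym 'k yalg = "'k ymonom \<Rightarrow>\<^sub>0 complex"

definition Ygen :: "'k long_word \<Rightarrow> 'k yalg" where
  "Ygen v = Poly_Mapping.single (Poly_Mapping.single v 1) 1"

text \<open>The value for the empty word is irrelevant.\<close>

definition Y :: "'k list \<Rightarrow> 'k yalg" where
  "Y w = (if 2 \<le> length w then Ygen (Abs_long_word w) else 1)"

definition Y_part :: "'k list \<Rightarrow> nat set set \<Rightarrow> 'k yalg" where
  "Y_part w \<pi> = (\<Prod>A\<in>\<pi>. Y (restrict_word w A))"

text \<open>
  The tensor square: its basis consists of the pairs \<open>(m, m')\<close> of monomials, standing for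
  \<open>m \<otimes> m'\<close>. Multiplication is that of the monoid algebra of the product monoid, i.e.
  \<open>(a \<otimes> b) (c \<otimes> d) = ac \<otimes> bd\<close>.
\<close>

type_synonym 'k yalg2 = "('k ymonom \<times> 'k ymonom) \<Rightarrow>\<^sub>0 complex"

definition tensor :: "'k yalg \<Rightarrow> 'k yalg \<Rightarrow> 'k yalg2" where
  "tensor a b =
     (\<Sum>m\<in>Poly_Mapping.keys a. \<Sum>m'\<in>Poly_Mapping.keys b.
        Poly_Mapping.single (m, m') (Poly_Mapping.lookup a m * Poly_Mapping.lookup b m'))"

text \<open>\<open>\<xi> \<otimes> \<eta>\<close> for linear functionals \<open>\<xi>\<close>, \<open>\<eta>\<close> (composed with \<open>\<complex> \<otimes> \<complex> \<cong> \<complex>\<close>).\<close>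

definition tensor_functional ::
  "('k yalg \<Rightarrow> complex) \<Rightarrow> ('k yalg \<Rightarrow> complex) \<Rightarrow> 'k yalg2 \<Rightarrow> complex" where
  "tensor_functional \<xi> \<eta> t =
     (\<Sum>(m, m')\<in>Poly_Mapping.keys t. Poly_Mapping.lookup t (m, m') *
        (\<xi> (Poly_Mapping.single m 1) * \<eta> (Poly_Mapping.single m' 1)))"

definition comult :: "'k yalg \<Rightarrow> 'k yalg2" where
  "comult =
     (THE D. unital_alg_hom cscale cscale D \<and>
        (\<forall>w. 2 \<le> length w \<longrightarrow>
           D (Y w) = (\<Sum>\<pi>\<in>NC (length w).
                        tensor (Y_part w \<pi>) (Y_part w (kreweras (length w) \<pi>)))))"

definition counit :: "'k yalg \<Rightarrow> complex" where
  "counit =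
     (THE e. unital_alg_hom cscale (*) e \<and> (\<forall>w. 2 \<le> length w \<longrightarrow> e (Y w) = 0))"

definition convolution ::
  "('k yalg \<Rightarrow> complex) \<Rightarrow> ('k yalg \<Rightarrow> complex) \<Rightarrow> ('k yalg \<Rightarrow> complex)" where
  "convolution \<xi> \<eta> = tensor_functional \<xi> \<eta> \<circ> comult"

primrec conv_power :: "('k yalg \<Rightarrow> complex) \<Rightarrow> nat \<Rightarrow> ('k yalg \<Rightarrow> complex)" where
  "conv_power \<xi> 0 = counit"
| "conv_power \<xi> (Suc l) = convolution (conv_power \<xi> l) \<xi>"

text \<open>
  For linear \<open>\<eta>\<close> with \<open>\<eta> 1 = 1\<close> the series has, at each element of the algebra, only finitely
  many non-zero terms. The summation index is \<open>\<ell> = Suc l\<close>.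
\<close>

definition conv_log :: "('k yalg \<Rightarrow> complex) \<Rightarrow> ('k yalg \<Rightarrow> complex)" where
  "conv_log \<eta> p =
     - suminf (\<lambda>l. 1 / of_nat (Suc l) * conv_power (\<lambda>q. counit q - \<eta> q) (Suc l) p)"


section \<open>The LS-transform\<close>

definition chi :: "('k ncpoly \<Rightarrow> complex) \<Rightarrow> 'k yalg \<Rightarrow> complex" where
  "chi \<mu> =
     (THE h. unital_alg_hom cscale (*) h \<and>
        (\<forall>w. 2 \<le> length w \<longrightarrow> h (Y w) = Cf w (R_transform \<mu>)))"

definition LS_transform :: "('k ncpoly \<Rightarrow> complex) \<Rightarrow> 'k ncps" where
  "LS_transform \<mu> w = (if 2 \<le> length w then conv_log (chi \<mu>) (Y w) else 0)"


section \<open>Well-definedness\<close>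

text \<open>
  The homomorphisms introduced above by definite description exist and are unique.
\<close>

lemma cscale_conv_mult:
  fixes p :: "'m::monoid_add \<Rightarrow>\<^sub>0 complex"
  shows "cscale c p = Poly_Mapping.single 0 c * p"
  by (simp add: cscale_def mult_map_scale_conv_mult)

lemma lookup_cscale [simp]: "Poly_Mapping.lookup (cscale c p) m = c * Poly_Mapping.lookup p m"
  by (simp add: cscale_def Poly_Mapping.map.rep_eq when_def)

lemma vector_space_cscale: "vector_space (cscale :: complex \<Rightarrow> ('m \<Rightarrow>\<^sub>0 complex) \<Rightarrow> _)"
  by standard
    (rule poly_mapping_eqI, simp add: lookup_add algebra_simps)+

lemma vector_space_complex: "vector_space ((*) :: complex \<Rightarrow> complex \<Rightarrow> complex)"
  by standard (simp_all add: algebra_simps)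

lemma poly_mapping_decomp:
  fixes p :: "'m \<Rightarrow>\<^sub>0 'b::comm_monoid_add"
  shows "p = (\<Sum>m\<in>Poly_Mapping.keys p. Poly_Mapping.single m (Poly_Mapping.lookup p m))"
  by (rule poly_mapping_eqI)
    (simp add: lookup_sum lookup_single when_def in_keys_iff sum.delta)

lemma linear_tensor_functional:
  fixes \<xi> \<eta> :: "'k yalg \<Rightarrow> complex"
  shows "linear_functional (tensor_functional \<xi> \<eta>)"
proof -
  have eq: "tensor_functional \<xi> \<eta> t =
      (\<Sum>x\<in>S. Poly_Mapping.lookup t x *
        (\<xi> (Poly_Mapping.single (fst x) 1) * \<eta> (Poly_Mapping.single (snd x) 1)))"
    if "finite S" "Poly_Mapping.keys t \<subseteq> S" for t S
    unfolding tensor_functional_def case_prod_unfold prod.collapse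
    by (rule sum.mono_neutral_left) (use that in \<open>auto simp: in_keys_iff\<close>)
  show ?thesis
    unfolding linear_functional_def
  proof (intro Vector_Spaces.linear.intro vector_space_cscale vector_space_complex
      module_hom.intro module_hom_axioms.intro)
    show "module (cscale :: _ \<Rightarrow> 'k yalg2 \<Rightarrow> _)"
      by (simp add: module_iff_vector_space vector_space_cscale)
    show "module ((*) :: complex \<Rightarrow> _ \<Rightarrow> _)"
      by (simp add: module_iff_vector_space vector_space_complex)
    show "tensor_functional \<xi> \<eta> (s + t) = tensor_functional \<xi> \<eta> s + tensor_functional \<xi> \<eta> t"
      for s t
    proof -
      let ?S = "Poly_Mapping.keys s \<union> Poly_Mapping.keys t"
      have "Poly_Mapping.keys (s + t) \<subseteq> ?S" by (rule Poly_Mapping.keys_add)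
      then show ?thesis
        by (simp add: eq[of ?S] lookup_add distrib_right sum.distrib)
    qed
    show "tensor_functional \<xi> \<eta> (cscale c t) = c * tensor_functional \<xi> \<eta> t" for c t
    proof -
      have "Poly_Mapping.keys (cscale c t) \<subseteq> Poly_Mapping.keys t"
        by (auto simp: in_keys_iff)
      then show ?thesis
        by (simp add: eq[of "Poly_Mapping.keys t"] sum_distrib_left mult.assoc)
    qed
  qed
qed

lemma tensor_functional_tensor:
  fixes \<xi> \<eta> :: "'k yalg \<Rightarrow> complex"
  assumes "linear_functional \<xi>" "linear_functional \<eta>"
  shows "tensor_functional \<xi> \<eta> (tensor a b) = \<xi> a * \<eta> b"
proof -
  have hom: "\<phi> p = (\<Sum>m\<in>Poly_Mapping.keys p. Poly_Mapping.lookup p m * \<phi> (Poly_Mapping.single m 1))"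
    if "linear_functional \<phi>" for \<phi> :: "'k yalg \<Rightarrow> complex" and p
  proof -
    interpret Vector_Spaces.linear cscale "(*)" \<phi>
      using that by (simp add: linear_functional_def)
    have "\<phi> p = (\<Sum>m\<in>Poly_Mapping.keys p. \<phi> (cscale (Poly_Mapping.lookup p m) (Poly_Mapping.single m 1)))"
      by (subst poly_mapping_decomp[of p]) (simp add: sum cscale_def)
    then show ?thesis by (simp add: scale)
  qed
  have rearrange: "(u * v) * (x * y) = (u * x) * (v * y)" for u v x y :: complex
    by (simp add: mult_ac)
  interpret T: Vector_Spaces.linear cscale "(*)" "tensor_functional \<xi> \<eta>"
    using linear_tensor_functional by (simp add: linear_functional_def)
  have single: "tensor_functional \<xi> \<eta> (Poly_Mapping.single (m, m') c) =
      c * (\<xi> (Poly_Mapping.single m 1) * \<eta> (Poly_Mapping.single m' 1))" for m m' c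
    by (simp add: tensor_functional_def)
  have "tensor_functional \<xi> \<eta> (tensor a b) =
      (\<Sum>m\<in>Poly_Mapping.keys a. \<Sum>m'\<in>Poly_Mapping.keys b.
        (Poly_Mapping.lookup a m * \<xi> (Poly_Mapping.single m 1)) *
        (Poly_Mapping.lookup b m' * \<eta> (Poly_Mapping.single m' 1)))"
    unfolding tensor_def T.sum single
    by (rule sum.cong[OF refl], rule sum.cong[OF refl], rule rearrange)
  also have "\<dots> = \<xi> a * \<eta> b"
    by (simp add: hom[OF assms(1), of a] hom[OF assms(2), of b] sum_product)
  finally show ?thesis .
qed

text \<open>
  Universal property of the polynomial algebra, for a target whose scalar multiplication
  is multiplication by \<open>\<iota> c\<close>.
\<close>

lemma unital_alg_hom_ex1:
  fixes \<iota> :: "complex \<Rightarrow> 'b::comm_ring_1" and g :: "'k list \<Rightarrow> 'b"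
  assumes add: "\<And>c d. \<iota> (c + d) = \<iota> c + \<iota> d"
    and mult: "\<And>c d. \<iota> (c * d) = \<iota> c * \<iota> d" and one: "\<iota> 1 = 1"
    and s: "\<And>c b. s c b = \<iota> c * b"
  shows "\<exists>!h. unital_alg_hom cscale s h \<and> (\<forall>w. 2 \<le> length w \<longrightarrow> h (Y w :: 'k yalg) = g w)"
proof -
  have zero: "\<iota> 0 = 0" using add[of 0 0] by simp
  have vs: "vector_space s"
    by standard (simp_all add: s add mult one algebra_simps)
  define G where "G v = g (Rep_long_word v)" for v
  define M where "M m = (\<Prod>v\<in>Poly_Mapping.keys m. G v ^ Poly_Mapping.lookup m v)" for m
  have M_eq: "M m = (\<Prod>v\<in>S. G v ^ Poly_Mapping.lookup m v)"
    if "finite S" "Poly_Mapping.keys m \<subseteq> S" for m S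
    unfolding M_def
    by (rule prod.mono_neutral_left) (use that in \<open>auto simp: in_keys_iff\<close>)
  have M_add: "M (m + m') = M m * M m'" for m m'
  proof -
    let ?S = "Poly_Mapping.keys m \<union> Poly_Mapping.keys m'"
    have "Poly_Mapping.keys (m + m') \<subseteq> ?S" by (rule Poly_Mapping.keys_add)
    then show ?thesis
      by (simp add: M_eq[of ?S] lookup_add power_add prod.distrib)
  qed
  define h where
    "h p = (\<Sum>m\<in>Poly_Mapping.keys p. \<iota> (Poly_Mapping.lookup p m) * M m)" for p :: "'k yalg"
  have h_eq: "h p = (\<Sum>m\<in>S. \<iota> (Poly_Mapping.lookup p m) * M m)"
    if "finite S" "Poly_Mapping.keys p \<subseteq> S" for p S
    unfolding h_def
    by (rule sum.mono_neutral_left) (use that in \<open>auto simp: in_keys_iff zero\<close>)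
  have h_add: "h (p + q) = h p + h q" for p q
  proof -
    let ?S = "Poly_Mapping.keys p \<union> Poly_Mapping.keys q"
    have "Poly_Mapping.keys (p + q) \<subseteq> ?S" by (rule Poly_Mapping.keys_add)
    then show ?thesis
      by (simp add: h_eq[of ?S] lookup_add add distrib_right sum.distrib)
  qed
  have h_0: "h 0 = 0" by (simp add: h_def)
  have h_sum: "h (sum f A) = (\<Sum>x\<in>A. h (f x))" for f and A :: "'x set"
    by (induction A rule: infinite_finite_induct) (simp_all add: h_add h_0)
  have h_single: "h (Poly_Mapping.single m c) = \<iota> c * M m" for m c
    by (simp add: h_def zero)
  have h_mult: "h (p * q) = h p * h q" for p q
  proof -
    let ?t = "\<lambda>p m. Poly_Mapping.single m (Poly_Mapping.lookup p m) :: 'k yalg"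
    have "p * q = (\<Sum>m\<in>Poly_Mapping.keys p. ?t p m) * (\<Sum>m'\<in>Poly_Mapping.keys q. ?t q m')"
      by (rule arg_cong2[of _ _ _ _ "(*)"]; rule poly_mapping_decomp)
    also have "\<dots> = (\<Sum>m\<in>Poly_Mapping.keys p. \<Sum>m'\<in>Poly_Mapping.keys q. ?t p m * ?t q m')"
      by (rule sum_product)
    finally have "p * q = \<dots>" .
    then have "h (p * q) = (\<Sum>m\<in>Poly_Mapping.keys p. \<Sum>m'\<in>Poly_Mapping.keys q. h (?t p m * ?t q m'))"
      by (simp add: h_sum)
    also have "\<dots> = (\<Sum>m\<in>Poly_Mapping.keys p. \<Sum>m'\<in>Poly_Mapping.keys q.
        (\<iota> (Poly_Mapping.lookup p m) * M m) * (\<iota> (Poly_Mapping.lookup q m') * M m'))"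
      by (simp add: mult_single h_single M_add mult mult_ac)
    also have "\<dots> = h p * h q" by (simp add: h_def sum_product)
    finally show ?thesis .
  qed
  have h_1: "h 1 = 1"
    using h_single[of 0 1] by (simp add: one M_def)
  have h_scale: "h (cscale c p) = s c (h p)" for c p
    using h_single[of 0 c] by (simp add: cscale_conv_mult h_mult s M_def)
  have h_hom: "unital_alg_hom cscale s h"
    unfolding unital_alg_hom_def
    by (intro conjI allI h_1 h_mult Vector_Spaces.linear.intro vector_space_cscale vs
        module_hom.intro module_hom_axioms.intro h_add h_scale)
      (simp_all add: module_iff_vector_space vector_space_cscale vs)
  have h_Y: "h (Y w) = g w" if "2 \<le> length w" for w
    using that by (simp add: Y_def Ygen_def h_single one M_def G_def Abs_long_word_inverse)
  show ?thesis
  proof (rule ex1I[of _ h])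
    show "unital_alg_hom cscale s h \<and> (\<forall>w. 2 \<le> length w \<longrightarrow> h (Y w) = g w)"
      using h_hom h_Y by blast
  next
    fix f assume f: "unital_alg_hom cscale s f \<and> (\<forall>w. 2 \<le> length w \<longrightarrow> f (Y w) = g w)"
    then interpret F: Vector_Spaces.linear cscale s f by (simp add: unital_alg_hom_def)
    have f_1: "f 1 = 1" and f_mult: "f (p * q) = f p * f q" for p q
      using f by (simp_all add: unital_alg_hom_def)
    have f_gen: "f (Ygen v) = G v" for v
    proof -
      have "2 \<le> length (Rep_long_word v)" using Rep_long_word[of v] by simp
      then show ?thesis
        using f by (auto simp: Y_def G_def Rep_long_word_inverse dest!: spec[of _ "Rep_long_word v"])
    qed
    have f_pow: "f (Poly_Mapping.single (Poly_Mapping.single v n) 1) = G v ^ n" for v n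
    proof (induction n)
      case 0
      show ?case by (simp add: f_1)
    next
      case (Suc n)
      have "Poly_Mapping.single (Poly_Mapping.single v (Suc n)) 1 =
          Ygen v * Poly_Mapping.single (Poly_Mapping.single v n) 1"
        by (simp add: Ygen_def mult_single flip: single_add)
      then show ?case by (simp add: f_mult f_gen Suc)
    qed
    have f_monom: "f (Poly_Mapping.single (\<Sum>v\<in>A. Poly_Mapping.single v (e v)) 1) = (\<Prod>v\<in>A. G v ^ e v)"
      if "finite A" for A e
      using that
    proof (induction A)
      case empty
      show ?case by (simp add: f_1)
    next
      case (insert v A)
      then show ?case
        using f_mult[of "Poly_Mapping.single (Poly_Mapping.single v (e v)) 1"
            "Poly_Mapping.single (\<Sum>v\<in>A. Poly_Mapping.single v (e v)) 1"]
        by (simp add: mult_single f_pow)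
    qed
    have f_M: "f (Poly_Mapping.single m 1) = M m" for m
      using f_monom[of "Poly_Mapping.keys m" "Poly_Mapping.lookup m"]
      by (simp add: M_def flip: poly_mapping_decomp)
    have f_single: "f (Poly_Mapping.single m c) = \<iota> c * M m" for m c
      using F.scale[of c "Poly_Mapping.single m 1"] by (simp add: cscale_def f_M s)
    show "f = h"
    proof
      fix p
      show "f p = h p"
        by (subst poly_mapping_decomp[of p]) (simp add: F.sum f_single h_def)
    qed
  qed
qed

lemma counit_spec:
  "unital_alg_hom cscale (*) (counit :: 'k yalg \<Rightarrow> complex) \<and> (\<forall>w :: 'k list. 2 \<le> length w \<longrightarrow> counit (Y w) = 0)"
  unfolding counit_def
  by (rule theI'[OF unital_alg_hom_ex1[where \<iota> = "\<lambda>c. c" and g = "\<lambda>_ :: 'k list. 0"]]) simp_all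

lemma chi_spec:
  "unital_alg_hom cscale (*) (chi \<mu>) \<and>
   (\<forall>w. 2 \<le> length w \<longrightarrow> chi \<mu> (Y w) = Cf w (R_transform \<mu>))"
  unfolding chi_def
  by (rule theI'[OF unital_alg_hom_ex1[where \<iota> = "\<lambda>c. c"
        and g = "\<lambda>w. Cf w (R_transform \<mu>)"]]) simp_all

lemma comult_spec:
  "unital_alg_hom cscale cscale (comult :: 'k yalg \<Rightarrow> 'k yalg2) \<and>
   (\<forall>w :: 'k list. 2 \<le> length w \<longrightarrow>
      comult (Y w) = (\<Sum>\<pi>\<in>NC (length w).
                        tensor (Y_part w \<pi>) (Y_part w (kreweras (length w) \<pi>))))"
  unfolding comult_def
  by (rule theI'[OF unital_alg_hom_ex1[where \<iota> = "Poly_Mapping.single 0"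
        and g = "\<lambda>w :: 'k list. \<Sum>\<pi>\<in>NC (length w). tensor (Y_part w \<pi>) (Y_part w (kreweras (length w) \<pi>))"]])
    (simp_all add: single_add mult_single cscale_conv_mult)

end

theory Submission
  imports Defs "HOL-Library.FuncSet"
begin

text \<open>
  Write \<open>\<delta> = \<epsilon> - \<chi>\<^sub>\<mu>\<close>, so that \<open>log \<chi>\<^sub>\<mu> = - \<Sum>\<^sub>l \<delta>\<^sup>l / l\<close>. A recursion for the values of \<open>\<delta>\<^sup>l\<close> on the generators
  alone does not close, because the coproduct of \<open>Y\<^sub>w\<close> contains products of generators, and \<open>\<delta>\<close> is not
  multiplicative. The products that occur are however the \<open>Y\<^bsub>w;\<theta>\<^esub>\<close> with \<open>\<theta>\<close> a non-crossing partition,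
  and on these the comultiplication is again explicit (\<open>comult_Y_part\<close>):
  \<open>\<Delta>(Y\<^bsub>w;\<theta>\<^esub>) = \<Sum>\<^bsub>\<sigma> \<le> \<theta>\<^esub> Y\<^bsub>w;\<sigma>\<^esub> \<otimes> Y\<^bsub>w;\<kappa>(\<theta>,\<sigma>)\<^esub>\<close>, where \<open>\<kappa>(\<theta>,\<sigma>)\<close> is the relative Kreweras complement
  of \<open>\<sigma>\<close> in \<open>\<theta>\<close>.

  Since both the counit and \<open>\<chi>\<^sub>\<mu>\<close> are multiplicative, \<open>\<delta>(Y\<^bsub>w;\<tau>\<^esub>)\<close> is \<open>-Cf\<^bsub>w;\<tau>\<^esub>(R\<^sub>\<mu>)\<close> for \<open>\<tau> \<noteq> 0\<^sub>n\<close>, and it is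
  \<open>1 - 1 = 0\<close> for \<open>\<tau> = 0\<^sub>n\<close>. The complement of \<open>\<sigma>\<close> in \<open>\<theta>\<close> is \<open>0\<^sub>n\<close> only for \<open>\<sigma> = \<theta>\<close>
  (\<open>rel_kreweras_eq_zero_iff\<close>), so that
  \<open>\<delta>\<^bsup>l+1\<^esup>(Y\<^bsub>w;\<theta>\<^esub>) = -\<Sum>\<^bsub>\<sigma> < \<theta>\<^esub> \<delta>\<^sup>l(Y\<^bsub>w;\<sigma>\<^esub>) Cf\<^bsub>w;\<kappa>(\<theta>,\<sigma>)\<^esub>(R\<^sub>\<mu>)\<close>. Unfolding this recursion down to
  \<open>\<delta>\<^sup>0 = \<epsilon>\<close>, which only sees \<open>0\<^sub>n\<close>, yields the sum over the chains of length \<open>l\<close> from \<open>0\<^sub>n\<close> to \<open>\<theta>\<close>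
  (\<open>conv_power_Y_part\<close>). The theorem is the case \<open>\<theta> = 1\<^sub>n\<close>, summed over \<open>l\<close>.

  The formula for \<open>\<Delta>(Y\<^bsub>w;\<theta>\<^esub>)\<close> is the product of the formulas for \<open>\<Delta>(Y\<^bsub>w|A\<^esub>)\<close> over the blocks \<open>A\<close> of \<open>\<theta>\<close>: a
  partition below \<open>\<theta>\<close> is a family of non-crossing partitions of the blocks, and its relative complement
  is assembled from the Kreweras complements inside the blocks. To make this precise, Kreweras
  complements are described explicitly, for non-crossing partitions of any finite set \<open>A\<close> of numbers: two
  elements of \<open>A\<close> belong to the same block of the complement iff cutting \<open>A\<close> after the one or after the
  other separates the same pairs inside blocks of \<open>\<sigma>\<close> (\<open>kreweras_on\<close>). That this partition has the
  permutation required of the complement is \<open>cyclic_succ_kreweras_block\<close>; as a partition is determined by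
  its permutation (\<open>block_perm_inject\<close>), it is the complement. The description only refers to the order
  of \<open>A\<close>, hence is compatible with the monotone relabelling of \<open>A\<close> by \<open>{1..card A}\<close>.
\<close>

section \<open>Partitions and their block permutations\<close>

lemma partition_on_block_unique:
  assumes "partition_on X \<pi>" "A \<in> \<pi>" "B \<in> \<pi>" "i \<in> A" "i \<in> B"
  shows "A = B"
  using assms by (auto simp: partition_on_def disjoint_def)

lemma partition_on_obtain_block:
  assumes "partition_on X \<pi>" "i \<in> X"
  obtains A where "A \<in> \<pi>" "i \<in> A"
  using assms by (auto simp: partition_on_def)

lemma partition_on_block_subset: "partition_on X \<pi> \<Longrightarrow> A \<in> \<pi> \<Longrightarrow> A \<subseteq> X"
  by (auto simp: partition_on_def)

lemma partition_on_block_nonempty: "partition_on X \<pi> \<Longrightarrow> A \<in> \<pi> \<Longrightarrow> A \<noteq> {}"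
  by (auto simp: partition_on_def)

lemma partition_on_finite_block:
  assumes "partition_on X \<pi>" "finite X" "A \<in> \<pi>"
  shows "finite A"
  using assms finite_subset partition_on_block_subset by metis

lemma partition_on_finite:
  assumes "partition_on X \<pi>" "finite X"
  shows "finite \<pi>"
  using assms by (metis finite_UnionD partition_onD1)

lemma cyclic_succ_eq_next:
  assumes "finite B" "s \<in> B" "p < s" "\<forall>q\<in>B. q \<le> p \<or> s \<le> q"
  shows "cyclic_succ B p = s"
proof -
  have "Min {j \<in> B. p < j} = s"
    by (rule Min_eqI) (use assms in auto)
  then show ?thesis using assms by (auto simp: cyclic_succ_def)
qed

lemma cyclic_succ_eq_first:
  assumes "finite B" "s \<in> B" "\<forall>q\<in>B. s \<le> q \<and> q \<le> p"
  shows "cyclic_succ B p = s"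
proof -
  have "Min B = s"
    by (rule Min_eqI) (use assms in auto)
  then show ?thesis using assms by (auto simp: cyclic_succ_def not_less)
qed

lemma cyclic_succ_cases:
  assumes "finite B" "p \<in> B"
  obtains (next_elem) "p < cyclic_succ B p" "\<forall>q\<in>B. q \<le> p \<or> cyclic_succ B p \<le> q"
    | (first_elem) "\<forall>q\<in>B. cyclic_succ B p \<le> q \<and> q \<le> p"
proof (cases "\<exists>j\<in>B. p < j")
  case True
  have fin: "finite {j \<in> B. p < j}" "{j \<in> B. p < j} \<noteq> {}" using assms True by auto
  have eq: "cyclic_succ B p = Min {j \<in> B. p < j}" using True by (simp add: cyclic_succ_def)
  have "Min {j \<in> B. p < j} \<in> {j \<in> B. p < j}" by (rule Min_in[OF fin])
  moreover have "\<forall>q\<in>B. q \<le> p \<or> Min {j \<in> B. p < j} \<le> q"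
    using fin by (auto simp: not_le intro!: Min_le)
  ultimately show ?thesis using that(1) unfolding eq by auto
next
  case False
  then have "cyclic_succ B p = Min B" by (auto simp: cyclic_succ_def)
  then show ?thesis using that(2) assms False by (auto simp: not_less)
qed

lemma cyclic_succ_in:
  assumes "finite B" "p \<in> B"
  shows "cyclic_succ B p \<in> B"
proof (cases "\<exists>j\<in>B. p < j")
  case True
  then have "Min {j \<in> B. p < j} \<in> {j \<in> B. p < j}" using assms by (intro Min_in) auto
  then show ?thesis using True by (simp add: cyclic_succ_def)
next
  case False
  then show ?thesis using assms by (auto simp: cyclic_succ_def intro: Min_in)
qed

lemma inj_on_cyclic_succ:
  assumes "finite B"
  shows "inj_on (cyclic_succ B) B"
proof (rule linorder_inj_onI)
  fix i j :: nat assume ij: "i < j" "i \<in> B" "j \<in> B"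
  then show "cyclic_succ B i \<noteq> cyclic_succ B j"
    using cyclic_succ_cases[OF assms ij(2)] cyclic_succ_cases[OF assms ij(3)]
    by (smt (verit) leD le_trans nat_less_le)
qed auto

lemma bij_betw_cyclic_succ: "finite B \<Longrightarrow> bij_betw (cyclic_succ B) B B"
  by (simp add: bij_betw_def inj_on_cyclic_succ endo_inj_surj cyclic_succ_in image_subsetI)

text \<open>
  Since every element of a block is reached from every other one by iterating the cyclic successor,
  a block is recovered from the permutation as an orbit.
\<close>

lemma cyclic_succ_closed_subset_eq:
  assumes "finite B" "D \<subseteq> B" "D \<noteq> {}" "\<And>i. i \<in> D \<Longrightarrow> cyclic_succ B i \<in> D"
  shows "D = B"
proof
  have finD: "finite D" using assms finite_subset by blast
  have D: "Max D \<in> D" "cyclic_succ B (Max D) \<in> D" using assms finD by auto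
  then have nlt: "\<not> Max D < cyclic_succ B (Max D)" using Max_ge[OF finD] by (meson not_less)
  have "Max D \<in> B" using D assms by blast
  then have first: "\<forall>q\<in>B. cyclic_succ B (Max D) \<le> q"
    using cyclic_succ_cases[OF assms(1), of "Max D"] nlt by metis
  show "B \<subseteq> D"
  proof
    fix x assume "x \<in> B"
    then show "x \<in> D"
    proof (induction x rule: less_induct)
      case (less x)
      show ?case
      proof (cases "\<exists>y\<in>B. y < x")
        case False
        then have "x = cyclic_succ B (Max D)" using first less.prems D assms(2)
          by (metis le_neq_implies_less subsetD)
        then show ?thesis using D by simp
      next
        case True
        have fin: "finite {y\<in>B. y < x}" "{y\<in>B. y < x} \<noteq> {}" using True assms by auto
        define y where "y = Max {y\<in>B. y < x}"
        have y: "y \<in> B" "y < x" using Max_in[OF fin] by (auto simp: y_def)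
        have "\<forall>q\<in>B. q \<le> y \<or> x \<le> q"
          using Max_ge[OF fin(1)] by (auto simp: y_def not_le)
        then have "cyclic_succ B y = x"
          using y less.prems by (intro cyclic_succ_eq_next) (use assms in auto)
        then show ?thesis using less.IH[OF y(2,1)] assms(4) by metis
      qed
    qed
  qed
qed (use assms in auto)

lemma block_perm_block:
  assumes "partition_on X \<pi>" "A \<in> \<pi>" "i \<in> A"
  shows "block_perm \<pi> i = cyclic_succ A i"
proof -
  have "(THE B. B \<in> \<pi> \<and> i \<in> B) = A"
  proof (rule the_equality)
    show "B = A" if "B \<in> \<pi> \<and> i \<in> B" for B
      using partition_on_block_unique[OF assms(1) _ assms(2) _ assms(3)] that by blast
  qed (use assms in simp)
  moreover have "i \<in> \<Union>\<pi>" using assms(2,3) by blast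
  ultimately show ?thesis by (simp add: block_perm_def)
qed

lemma block_perm_outside: "partition_on X \<pi> \<Longrightarrow> i \<notin> X \<Longrightarrow> block_perm \<pi> i = i"
  by (auto simp: block_perm_def partition_on_def)

lemma bij_block_perm:
  assumes "partition_on X \<pi>" "finite X"
  shows "bij (block_perm \<pi>)"
proof (rule bijI)
  have block: "block_perm \<pi> i \<in> A" if "A \<in> \<pi>" "i \<in> A" for i A
    using that block_perm_block[OF assms(1) that] cyclic_succ_in
      partition_on_finite_block[OF assms that(1)] by simp
  show "inj (block_perm \<pi>)"
  proof (rule injI)
    fix i j assume eq: "block_perm \<pi> i = block_perm \<pi> j"
    show "i = j"
    proof (cases "i \<in> X \<and> j \<in> X")
      case True
      then obtain A B where AB: "A \<in> \<pi>" "i \<in> A" "B \<in> \<pi>" "j \<in> B"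
        using partition_on_obtain_block[OF assms(1)] by metis
      then have "A = B"
        using block eq partition_on_block_unique[OF assms(1)] by metis
      then show ?thesis
        using AB eq block_perm_block[OF assms(1)] inj_on_cyclic_succ
          partition_on_finite_block[OF assms] by (metis inj_onD)
    next
      case False
      have "i \<in> X \<Longrightarrow> block_perm \<pi> i \<in> X" for i
        using block partition_on_obtain_block[OF assms(1)] partition_on_block_subset[OF assms(1)]
        by (metis subsetD)
      then show ?thesis
        using False eq block_perm_outside[OF assms(1)] by metis
    qed
  qed
  show "surj (block_perm \<pi>)"
  proof (rule surj_def[THEN iffD2])
    show "\<forall>y. \<exists>x. y = block_perm \<pi> x"
    proof
      fix y
      show "\<exists>x. y = block_perm \<pi> x"
      proof (cases "y \<in> X")
        case True
        then obtain A where A: "A \<in> \<pi>" "y \<in> A"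
          using partition_on_obtain_block[OF assms(1)] by metis
        then obtain x where "x \<in> A" "y = cyclic_succ A x"
          using bij_betw_cyclic_succ partition_on_finite_block[OF assms]
          by (metis bij_betw_imp_surj_on imageE)
        then show ?thesis using A block_perm_block[OF assms(1)] by metis
      next
        case False
        then show ?thesis using block_perm_outside[OF assms(1)] by metis
      qed
    qed
  qed
qed

lemma block_perm_inject:
  assumes "partition_on X \<pi>" "partition_on X \<rho>" "finite X" "block_perm \<pi> = block_perm \<rho>"
  shows "\<pi> = \<rho>"
proof -
  have sub: "\<pi> \<subseteq> \<rho>"
    if p: "partition_on X \<pi>" "partition_on X \<rho>" and eq: "block_perm \<pi> = block_perm \<rho>"
    for \<pi> \<rho> :: "nat set set"
  proof
    fix A assume A: "A \<in> \<pi>"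
    then obtain i where i: "i \<in> A" using partition_on_block_nonempty[OF p(1)] by blast
    then obtain C where C: "C \<in> \<rho>" "i \<in> C"
      using partition_on_obtain_block[OF p(2)] partition_on_block_subset[OF p(1) A] by (metis subsetD)
    have fin: "finite A" "finite C"
      using A C partition_on_finite_block[OF _ assms(3)] p by blast+
    have "cyclic_succ A j \<in> A \<inter> C \<and> cyclic_succ C j \<in> A \<inter> C" if "j \<in> A \<inter> C" for j
    proof -
      have "cyclic_succ A j = cyclic_succ C j"
        using block_perm_block[OF p(1) A, of j] block_perm_block[OF p(2) C(1), of j] eq that by simp
      then show ?thesis using cyclic_succ_in[OF fin(1), of j] cyclic_succ_in[OF fin(2), of j] that by auto
    qed
    then have "A \<inter> C = A" "A \<inter> C = C"
      using cyclic_succ_closed_subset_eq[OF fin(1)] cyclic_succ_closed_subset_eq[OF fin(2)] i C(2)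
      by (metis Int_iff empty_iff inf_le1 inf_le2)+
    then show "A \<in> \<rho>" using C by simp
  qed
  show ?thesis using sub[OF assms(1,2,4)] sub[OF assms(2,1) assms(4)[symmetric]] by blast
qed

section \<open>The Kreweras complement\<close>

definition nc_partitions :: "nat set \<Rightarrow> nat set set set" where
  "nc_partitions A = {\<pi>. partition_on A \<pi> \<and> noncrossing \<pi>}"

lemma NC_eq: "NC n = nc_partitions {1..n}"
  by (simp add: NC_def nc_partitions_def)

lemma nc_partitionsD:
  assumes "\<pi> \<in> nc_partitions A"
  shows "partition_on A \<pi>" "noncrossing \<pi>"
  using assms by (auto simp: nc_partitions_def)

lemma finite_nc_partitions: "finite A \<Longrightarrow> finite (nc_partitions A)"
  by (rule finite_subset[of _ "Pow (Pow A)"]) (auto simp: nc_partitions_def partition_on_def)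

lemma finite_NC: "finite (NC n)"
  by (simp add: NC_eq finite_nc_partitions)

text \<open>
  The pairs of elements of one block that are torn apart by a cut between \<open>i\<close> and \<open>i + 1\<close>. For \<open>i < j\<close>,
  the cuts after \<open>i\<close> and after \<open>j\<close> separate the same pairs iff every block of \<open>\<sigma>\<close> is contained in
  \<open>{i<..j}\<close> or disjoint from it. Expressing this as an equality of two sets makes it evident that it is
  an equivalence relation.
\<close>

definition separated_pairs :: "nat set set \<Rightarrow> nat \<Rightarrow> (nat \<times> nat) set" where
  "separated_pairs \<sigma> i = {(x, y). \<exists>B\<in>\<sigma>. x \<in> B \<and> y \<in> B \<and> (x \<le> i \<longleftrightarrow> i < y)}"

definition kreweras_block :: "nat set \<Rightarrow> nat set set \<Rightarrow> nat \<Rightarrow> nat set" where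
  "kreweras_block A \<sigma> i = {j \<in> A. separated_pairs \<sigma> j = separated_pairs \<sigma> i}"

definition kreweras_on :: "nat set \<Rightarrow> nat set set \<Rightarrow> nat set set" where
  "kreweras_on A \<sigma> = kreweras_block A \<sigma> ` A"

lemma separated_pairs_eqI:
  assumes "\<And>B x y. B \<in> \<sigma> \<Longrightarrow> x \<in> B \<Longrightarrow> y \<in> B \<Longrightarrow> (x \<le> i \<longleftrightarrow> i < y) = (x \<le> j \<longleftrightarrow> j < y)"
  shows "separated_pairs \<sigma> i = separated_pairs \<sigma> j"
  using assms unfolding separated_pairs_def by blast

lemma separated_pairs_eqD:
  assumes "partition_on X \<sigma>" "separated_pairs \<sigma> i = separated_pairs \<sigma> j"
    "B \<in> \<sigma>" "x \<in> B" "y \<in> B"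
  shows "(x \<le> i \<longleftrightarrow> i < y) = (x \<le> j \<longleftrightarrow> j < y)"
proof -
  have "(x, y) \<in> separated_pairs \<sigma> k \<longleftrightarrow> (x \<le> k \<longleftrightarrow> k < y)" for k
    using assms(3-5) by (auto simp: separated_pairs_def)
  then show ?thesis using assms(2) by metis
qed

lemma partition_on_kreweras_on: "partition_on A (kreweras_on A \<sigma>)"
  by (rule partition_onI) (auto simp: kreweras_on_def kreweras_block_def disjnt_def)

text \<open>
  For \<open>a < b < c < d\<close> the interval \<open>{b<..c}\<close> is the intersection of \<open>{a<..c}\<close> and \<open>{b<..d}\<close>. Hence a
  block of \<open>\<sigma>\<close> cannot be split by \<open>{b<..c}\<close> if it is not split by the other two, and so \<open>b\<close> and \<open>c\<close> are
  equivalent if \<open>a\<close> and \<open>c\<close> as well as \<open>b\<close> and \<open>d\<close> are.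
\<close>

lemma noncrossing_kreweras_on:
  assumes "partition_on X \<sigma>"
  shows "noncrossing (kreweras_on A \<sigma>)"
  unfolding noncrossing_def
proof (intro ballI impI notI)
  fix C D assume CD: "C \<in> kreweras_on A \<sigma>" "D \<in> kreweras_on A \<sigma>" "C \<noteq> D"
  assume "\<exists>a b c d. a < b \<and> b < c \<and> c < d \<and> a \<in> C \<and> c \<in> C \<and> b \<in> D \<and> d \<in> D"
  then obtain a b c d where *: "a < b" "b < c" "c < d" "a \<in> C" "c \<in> C" "b \<in> D" "d \<in> D"
    by blast
  have ac: "separated_pairs \<sigma> a = separated_pairs \<sigma> c" and bd: "separated_pairs \<sigma> b = separated_pairs \<sigma> d"
    using CD * by (auto simp: kreweras_on_def kreweras_block_def)
  have "separated_pairs \<sigma> b = separated_pairs \<sigma> c"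
  proof (rule separated_pairs_eqI)
    fix B x y assume B: "B \<in> \<sigma>" "x \<in> B" "y \<in> B"
    show "(x \<le> b \<longleftrightarrow> b < y) = (x \<le> c \<longleftrightarrow> c < y)"
      using separated_pairs_eqD[OF assms ac B] separated_pairs_eqD[OF assms bd B] *(1-3) by linarith
  qed
  then show False using CD * by (auto simp: kreweras_on_def kreweras_block_def)
qed

text \<open>
  The permutation of the complement is \<open>P\<^sub>\<sigma>\<^sup>-\<^sup>1 P\<close>, where \<open>P\<close> is the cycle of \<open>A\<close>: the successor of \<open>i\<close> in
  its equivalence class is the predecessor \<open>p\<close>, inside the block \<open>B\<close> of \<open>\<sigma>\<close>, of the successor \<open>s\<close> of \<open>i\<close>
  in \<open>A\<close>. The cuts after \<open>p\<close> and after \<open>i\<close> are equivalent because no element of \<open>B\<close> lies strictly between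
  \<open>p\<close> and \<open>s\<close> in the cyclic order, so a block with elements on both sides would cross \<open>B\<close>. A cut in
  between is not equivalent to them since it treats the pair \<open>(s, p)\<close> differently.
\<close>

lemma cyclic_succ_kreweras_block:
  assumes A: "finite A" and \<sigma>: "\<sigma> \<in> nc_partitions A" and i: "i \<in> A"
    and B: "B \<in> \<sigma>" and p: "p \<in> B" and eq: "cyclic_succ B p = cyclic_succ A i"
  shows "cyclic_succ (kreweras_block A \<sigma> i) i = p"
proof -
  note part = nc_partitionsD(1)[OF \<sigma>]
  have cross: "\<not> (a < b \<and> b < c \<and> c < d \<or> d < a \<and> a < b \<and> b < c)"
    if "B' \<in> \<sigma>" "B' \<noteq> B" "a \<in> B" "c \<in> B" "b \<in> B'" "d \<in> B'" for B' a b c d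
    using nc_partitionsD(2)[OF \<sigma>] that B unfolding noncrossing_def by metis
  have disj: "x \<noteq> y" if "B' \<in> \<sigma>" "B' \<noteq> B" "x \<in> B" "y \<in> B'" for B' x y
    using partition_on_block_unique[OF part that(1) B] that by blast
  have finB: "finite B" using partition_on_finite_block[OF part A B] .
  have BA: "B \<subseteq> A" using partition_on_block_subset[OF part B] .
  have blockA: "x \<in> A" if "B' \<in> \<sigma>" "x \<in> B'" for B' x
    using partition_on_block_subset[OF part] that by blast
  have fin: "finite (kreweras_block A \<sigma> i)" using A by (simp add: kreweras_block_def)
  define s where "s = cyclic_succ A i"
  have sB: "s \<in> B" using cyclic_succ_in[OF finB p] eq by (simp add: s_def)
  then have sA: "s \<in> A" and pA: "p \<in> A" using BA p by auto
  have cutp: "p \<in> kreweras_block A \<sigma> i"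
    if "\<And>B' x y. B' \<in> \<sigma> \<Longrightarrow> x \<in> B' \<Longrightarrow> y \<in> B' \<Longrightarrow> x < y \<Longrightarrow>
      (x \<le> p \<and> p < y) = (x \<le> i \<and> i < y)"
  proof -
    have "separated_pairs \<sigma> p = separated_pairs \<sigma> i"
    proof (rule separated_pairs_eqI)
      fix B' x y assume *: "B' \<in> \<sigma>" "x \<in> B'" "y \<in> B'"
      show "(x \<le> p \<longleftrightarrow> p < y) = (x \<le> i \<longleftrightarrow> i < y)"
        using that[OF *] that[OF *(1,3,2)] by (cases x y rule: linorder_cases) (auto)
    qed
    then show ?thesis using pA by (simp add: kreweras_block_def)
  qed
  have sep: "(s \<le> q \<longleftrightarrow> q < p) = (s \<le> i \<longleftrightarrow> i < p)" if "q \<in> kreweras_block A \<sigma> i" for q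
    by (rule separated_pairs_eqD[OF part _ B sB p]) (use that in \<open>simp add: kreweras_block_def\<close>)
  have KA: "q \<in> A" if "q \<in> kreweras_block A \<sigma> i" for q
    using that by (simp add: kreweras_block_def)
  from A i show ?thesis
  proof (cases rule: cyclic_succ_cases)
    case next_elem
    note iA = next_elem[folded s_def]
    from finB p show ?thesis
    proof (cases rule: cyclic_succ_cases)
      case next_elem
      note pB = next_elem[unfolded eq, folded s_def]
      \<comment> \<open>\<open>p \<le> i < s\<close>: going up from \<open>i\<close>, the class wraps around, and \<open>p\<close> is its minimum.\<close>
      have "p \<le> i" using iA pB pA by fastforce
      have "p \<in> kreweras_block A \<sigma> i"
      proof (rule cutp)
        fix B' x y assume *: "B' \<in> \<sigma>" "x \<in> B'" "y \<in> B'" "x < y"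
        show "(x \<le> p \<and> p < y) = (x \<le> i \<and> i < y)"
        proof (cases "B' = B")
          case True
          then have "x \<le> p \<or> s \<le> x" "y \<le> p \<or> s \<le> y" using pB *(2,3) by auto
          then show ?thesis using iA(1) \<open>p \<le> i\<close> by linarith
        next
          case False
          have "x \<noteq> p" "x \<noteq> s" "y \<noteq> p" "y \<noteq> s" using disj[OF *(1) False] * p sB by auto
          moreover have "x \<le> i \<or> s \<le> x" "y \<le> i \<or> s \<le> y" using iA blockA * by auto
          ultimately show ?thesis
            using cross[OF *(1) False p sB *(2,3)] cross[OF *(1) False p sB *(3,2)] iA(1) \<open>p \<le> i\<close> *(4)
            by auto
        qed
      qed
      moreover have "p \<le> q \<and> q \<le> i" if "q \<in> kreweras_block A \<sigma> i" for q
        using sep[OF that] iA(1) bspec[OF iA(2)] pB(1) \<open>p \<le> i\<close> KA[OF that] by auto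
      ultimately show ?thesis by (intro cyclic_succ_eq_first[OF fin] ballI)
    next
      case first_elem
      note pB = first_elem[unfolded eq, folded s_def]
      \<comment> \<open>\<open>s\<close> and \<open>p\<close> are the minimum and the maximum of \<open>B\<close>, and \<open>B\<close> lies above \<open>i\<close>.\<close>
      have "i < p" using iA pB sB by fastforce
      have "p \<in> kreweras_block A \<sigma> i"
      proof (rule cutp)
        fix B' x y assume *: "B' \<in> \<sigma>" "x \<in> B'" "y \<in> B'" "x < y"
        show "(x \<le> p \<and> p < y) = (x \<le> i \<and> i < y)"
        proof (cases "B' = B")
          case True
          then have "s \<le> x" "y \<le> p" using pB *(2,3) by auto
          moreover have "x \<le> i \<or> s \<le> x" "y \<le> i \<or> s \<le> y" using iA blockA * by auto
          ultimately show ?thesis using iA(1) \<open>i < p\<close> \<open>x < y\<close> by linarith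
        next
          case False
          have "x \<noteq> p" "x \<noteq> s" "y \<noteq> p" "y \<noteq> s" using disj[OF *(1) False] * p sB by auto
          moreover have "x \<le> i \<or> s \<le> x" "y \<le> i \<or> s \<le> y" using iA blockA * by auto
          ultimately show ?thesis
            using cross[OF *(1) False sB p *(2,3)] cross[OF *(1) False sB p *(3,2)] iA(1) \<open>i < p\<close> *(4)
            by auto
        qed
      qed
      moreover have "q \<le> i \<or> p \<le> q" if "q \<in> kreweras_block A \<sigma> i" for q
        using sep[OF that] iA(1) bspec[OF iA(2)] \<open>i < p\<close> KA[OF that] by auto
      ultimately show ?thesis using \<open>i < p\<close> by (intro cyclic_succ_eq_next[OF fin] ballI)
    qed
  next
    case first_elem
    note iA = first_elem[folded s_def]
    \<comment> \<open>\<open>i\<close> and \<open>s\<close> are the maximum and the minimum of \<open>A\<close>, so \<open>p\<close> must be the maximum of \<open>B\<close>.\<close>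
    have pB: "\<forall>q\<in>B. s \<le> q \<and> q \<le> p"
      using finB p
    proof (cases rule: cyclic_succ_cases)
      case next_elem
      then show ?thesis using iA pA sA eq by (auto simp: s_def)
    next
      case first_elem
      then show ?thesis by (simp add: eq s_def)
    qed
    have "p \<le> i" using iA pA by blast
    have "p \<in> kreweras_block A \<sigma> i"
    proof (rule cutp)
      fix B' x y assume *: "B' \<in> \<sigma>" "x \<in> B'" "y \<in> B'" "x < y"
      show "(x \<le> p \<and> p < y) = (x \<le> i \<and> i < y)"
      proof (cases "B' = B")
        case True
        then have "x \<le> p" "y \<le> p" using pB *(2,3) by auto
        then show ?thesis using \<open>p \<le> i\<close> by linarith
      next
        case False
        have "x \<noteq> p" "x \<noteq> s" "y \<noteq> p" "y \<noteq> s" using disj[OF *(1) False] * p sB by auto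
        moreover have "s \<le> x" "x \<le> i" "y \<le> i" using iA blockA * by auto
        ultimately show ?thesis
          using cross[OF *(1) False sB p *(2,3)] \<open>p \<le> i\<close> *(4)
          by auto
      qed
    qed
    moreover have "p \<le> q \<and> q \<le> i" if "q \<in> kreweras_block A \<sigma> i" for q
      using sep[OF that] bspec[OF iA] bspec[OF pB p] \<open>p \<le> i\<close> KA[OF that] by auto
    ultimately show ?thesis by (intro cyclic_succ_eq_first[OF fin] ballI)
  qed
qed

lemma block_perm_subpartition:
  assumes "partition_on X \<pi>" "partition_on A \<pi>'" "\<pi>' \<subseteq> \<pi>" "i \<in> A"
  shows "block_perm \<pi>' i = block_perm \<pi> i"
proof -
  obtain B where "B \<in> \<pi>'" "i \<in> B" using partition_on_obtain_block[OF assms(2,4)] by blast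
  then show ?thesis
    using block_perm_block[OF assms(1)] block_perm_block[OF assms(2)] assms(3) by (metis subsetD)
qed

lemma block_perm_kreweras_on:
  assumes "finite A" "\<sigma> \<in> nc_partitions A" "i \<in> A"
  shows "block_perm (kreweras_on A \<sigma>) i \<in> A"
    and "block_perm \<sigma> (block_perm (kreweras_on A \<sigma>) i) = cyclic_succ A i"
proof -
  note part = nc_partitionsD(1)[OF assms(2)]
  obtain B where B: "B \<in> \<sigma>" "cyclic_succ A i \<in> B"
    using partition_on_obtain_block[OF part] cyclic_succ_in[OF assms(1,3)] by metis
  then obtain p where p: "p \<in> B" "cyclic_succ B p = cyclic_succ A i"
    using bij_betw_cyclic_succ[OF partition_on_finite_block[OF part assms(1)]]
    by (metis bij_betw_imp_surj_on imageE)
  have "block_perm (kreweras_on A \<sigma>) i = cyclic_succ (kreweras_block A \<sigma> i) i"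
    using assms(3) by (intro block_perm_block[OF partition_on_kreweras_on])
      (auto simp: kreweras_on_def kreweras_block_def)
  also have "\<dots> = p" using cyclic_succ_kreweras_block[OF assms B(1) p] .
  finally have *: "block_perm (kreweras_on A \<sigma>) i = p" .
  then show "block_perm (kreweras_on A \<sigma>) i \<in> A"
    using p B partition_on_block_subset[OF part] by auto
  show "block_perm \<sigma> (block_perm (kreweras_on A \<sigma>) i) = cyclic_succ A i"
    unfolding * using block_perm_block[OF part B(1) p(1)] p(2) by simp
qed

section \<open>Intervals below a partition\<close>

lemma nc_le_iff:
  assumes "partition_on X \<pi>" "partition_on X \<rho>"
  shows "nc_le \<pi> \<rho> \<longleftrightarrow> (\<forall>B\<in>\<pi>. \<exists>A\<in>\<rho>. B \<subseteq> A)"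
proof (intro iffI ballI)
  fix B assume le: "nc_le \<pi> \<rho>" and B: "B \<in> \<pi>"
  obtain i where i: "i \<in> B" using partition_on_block_nonempty[OF assms(1) B] by blast
  then obtain A where A: "A \<in> \<rho>" "i \<in> A"
    using partition_on_obtain_block[OF assms(2)] partition_on_block_subset[OF assms(1) B]
    by (metis subsetD)
  obtain S where S: "S \<subseteq> \<pi>" "A = \<Union>S" using le A(1) by (auto simp: nc_le_def)
  then obtain C where C: "C \<in> S" "i \<in> C" using A by blast
  then have "C = B" using partition_on_block_unique[OF assms(1)] S B i by blast
  then show "\<exists>A\<in>\<rho>. B \<subseteq> A" using A S C by blast
next
  assume le: "\<forall>B\<in>\<pi>. \<exists>A\<in>\<rho>. B \<subseteq> A"
  show "nc_le \<pi> \<rho>"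
    unfolding nc_le_def
  proof
    fix A assume A: "A \<in> \<rho>"
    have "A = \<Union>{B \<in> \<pi>. B \<subseteq> A}"
    proof
      show "A \<subseteq> \<Union>{B \<in> \<pi>. B \<subseteq> A}"
      proof
        fix i assume i: "i \<in> A"
        then obtain B where B: "B \<in> \<pi>" "i \<in> B"
          using partition_on_obtain_block[OF assms(1)] partition_on_block_subset[OF assms(2) A]
          by (metis subsetD)
        then obtain A' where A': "A' \<in> \<rho>" "B \<subseteq> A'" using le by blast
        then have "A' = A" using partition_on_block_unique[OF assms(2) A'(1) A] B i by blast
        then show "i \<in> \<Union>{B \<in> \<pi>. B \<subseteq> A}" using B A' by blast
      qed
    qed blast
    then show "\<exists>S\<subseteq>\<pi>. A = \<Union>S" by (intro exI[of _ "{B \<in> \<pi>. B \<subseteq> A}"]) simp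
  qed
qed

definition blocks_within :: "nat set \<Rightarrow> nat set set \<Rightarrow> nat set set" where
  "blocks_within A \<sigma> = {B \<in> \<sigma>. B \<subseteq> A}"

lemma blocks_within_subset: "blocks_within A \<sigma> \<subseteq> \<sigma>"
  by (auto simp: blocks_within_def)

lemma noncrossingD:
  assumes "noncrossing \<pi>" "A \<in> \<pi>" "B \<in> \<pi>"
    and "a < b" "b < c" "c < d" "a \<in> A" "c \<in> A" "b \<in> B" "d \<in> B"
  shows "A = B"
  using assms unfolding noncrossing_def by metis

lemma noncrossing_subset: "noncrossing \<sigma> \<Longrightarrow> \<sigma>' \<subseteq> \<sigma> \<Longrightarrow> noncrossing \<sigma>'"
  unfolding noncrossing_def by (meson subsetD)

lemma blocks_within_nc:
  assumes "\<sigma> \<in> nc_partitions X" "partition_on X \<theta>" "nc_le \<sigma> \<theta>" "A \<in> \<theta>"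
  shows "blocks_within A \<sigma> \<in> nc_partitions A"
proof -
  note \<sigma> = nc_partitionsD[OF assms(1)]
  obtain S where "S \<subseteq> \<sigma>" "A = \<Union>S" using assms(3,4) by (auto simp: nc_le_def)
  then have "\<Union>(blocks_within A \<sigma>) = A" by (auto simp: blocks_within_def)
  moreover have "disjoint (blocks_within A \<sigma>)" "{} \<notin> blocks_within A \<sigma>"
    using \<sigma>(1) by (auto simp: partition_on_def blocks_within_def disjoint_def)
  ultimately show ?thesis
    using noncrossing_subset[OF \<sigma>(2) blocks_within_subset]
    by (simp add: nc_partitions_def partition_on_def)
qed

lemma UN_blocks_within:
  assumes "partition_on X \<sigma>" "partition_on X \<theta>" "nc_le \<sigma> \<theta>"
  shows "(\<Union>A\<in>\<theta>. blocks_within A \<sigma>) = \<sigma>"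
  using assms(3) unfolding nc_le_iff[OF assms(1,2)] blocks_within_def by blast

lemma UN_nc_partitions:
  assumes \<theta>: "\<theta> \<in> nc_partitions X" and g: "\<And>A. A \<in> \<theta> \<Longrightarrow> g A \<in> nc_partitions A"
  shows "(\<Union>A\<in>\<theta>. g A) \<in> nc_partitions X"
    and "nc_le (\<Union>A\<in>\<theta>. g A) \<theta>"
    and "\<And>A. A \<in> \<theta> \<Longrightarrow> blocks_within A (\<Union>A\<in>\<theta>. g A) = g A"
proof -
  note p\<theta> = nc_partitionsD[OF \<theta>] and pg = nc_partitionsD[OF g]
  have part: "partition_on X (\<Union>A\<in>\<theta>. g A)"
  proof (rule partition_onI)
    show "\<Union>(\<Union>A\<in>\<theta>. g A) = X" using p\<theta>(1) pg(1) unfolding partition_on_def by blast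
    show "{} \<notin> (\<Union>A\<in>\<theta>. g A)" using pg(1) unfolding partition_on_def by blast
    fix B C assume "B \<in> (\<Union>A\<in>\<theta>. g A)" "C \<in> (\<Union>A\<in>\<theta>. g A)" "B \<noteq> C"
    then obtain A A' where A: "A \<in> \<theta>" "B \<in> g A" "A' \<in> \<theta>" "C \<in> g A'" by blast
    have "x \<notin> C" if x: "x \<in> B" for x
    proof
      assume "x \<in> C"
      moreover have "B \<subseteq> A" "C \<subseteq> A'" using partition_on_block_subset pg(1) A by metis+
      ultimately have "A' = A" using partition_on_block_unique[OF p\<theta>(1) A(3,1)] x by blast
      then show False
        using partition_on_block_unique[OF pg(1)[OF A(1)] A(2)] A(4) x \<open>x \<in> C\<close> \<open>B \<noteq> C\<close> by blast
    qed
    then show "disjnt B C" by (auto simp: disjnt_def)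
  qed
  have "noncrossing (\<Union>A\<in>\<theta>. g A)"
    unfolding noncrossing_def
  proof (intro ballI impI notI)
    fix B C assume BC: "B \<in> (\<Union>A\<in>\<theta>. g A)" "C \<in> (\<Union>A\<in>\<theta>. g A)" "B \<noteq> C"
      and "\<exists>a b c d. a < b \<and> b < c \<and> c < d \<and> a \<in> B \<and> c \<in> B \<and> b \<in> C \<and> d \<in> C"
    then obtain a b c d where
      cross: "a < b" "b < c" "c < d" and mem: "a \<in> B" "c \<in> B" "b \<in> C" "d \<in> C" by blast
    from BC obtain A A' where A: "A \<in> \<theta>" "B \<in> g A" "A' \<in> \<theta>" "C \<in> g A'" by blast
    have "B \<subseteq> A" "C \<subseteq> A'" using partition_on_block_subset pg(1) A by metis+
    then have "a \<in> A" "c \<in> A" "b \<in> A'" "d \<in> A'" using mem by auto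
    then have "A = A'" by (rule noncrossingD[OF p\<theta>(2) A(1,3) cross])
    then have "C \<in> g A" using A(4) by simp
    then show False using noncrossingD[OF pg(2)[OF A(1)] A(2) _ cross mem] BC(3) by blast
  qed
  with part show "(\<Union>A\<in>\<theta>. g A) \<in> nc_partitions X" by (simp add: nc_partitions_def)
  show "nc_le (\<Union>A\<in>\<theta>. g A) \<theta>"
    unfolding nc_le_iff[OF part p\<theta>(1)] using partition_on_block_subset[OF pg(1)] by blast
  show "blocks_within A (\<Union>A\<in>\<theta>. g A) = g A" if A: "A \<in> \<theta>" for A
  proof
    show "blocks_within A (\<Union>A\<in>\<theta>. g A) \<subseteq> g A"
    proof
      fix B assume "B \<in> blocks_within A (\<Union>A\<in>\<theta>. g A)"
      then obtain A' where A': "A' \<in> \<theta>" "B \<in> g A'" "B \<subseteq> A" by (auto simp: blocks_within_def)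
      then obtain i where "i \<in> B" "i \<in> A'"
        using partition_on_block_nonempty[OF pg(1)] partition_on_block_subset[OF pg(1)] by blast
      then have "A' = A" using partition_on_block_unique[OF p\<theta>(1) A'(1) A] A' by blast
      then show "B \<in> g A" using A' by simp
    qed
    show "g A \<subseteq> blocks_within A (\<Union>A\<in>\<theta>. g A)"
      using A partition_on_block_subset[OF pg(1)[OF A]] by (auto simp: blocks_within_def)
  qed
qed

text \<open>
  The order ideal below \<open>\<theta>\<close> is the product of the lattices of non-crossing partitions of its blocks. No
  crossing arises between blocks that lie in different blocks of \<open>\<theta>\<close>, as it would be a crossing of \<open>\<theta>\<close>.
\<close>

lemma bij_betw_blocks_within:
  assumes \<theta>: "\<theta> \<in> nc_partitions X"
  shows "bij_betw (\<lambda>g. \<Union>A\<in>\<theta>. g A) (PiE \<theta> nc_partitions) {\<sigma> \<in> nc_partitions X. nc_le \<sigma> \<theta>}"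
proof (rule bij_betw_byWitness[where f' = "\<lambda>\<sigma>. \<lambda>A\<in>\<theta>. blocks_within A \<sigma>"])
  show "\<forall>g\<in>PiE \<theta> nc_partitions. (\<lambda>A\<in>\<theta>. blocks_within A (\<Union>A\<in>\<theta>. g A)) = g"
  proof
    fix g assume g: "g \<in> PiE \<theta> nc_partitions"
    then have "blocks_within A (\<Union>A\<in>\<theta>. g A) = g A" if "A \<in> \<theta>" for A
      using that by (intro UN_nc_partitions(3)[OF \<theta>]) (rule PiE_mem)
    then have "(\<lambda>A\<in>\<theta>. blocks_within A (\<Union>A\<in>\<theta>. g A)) = restrict g \<theta>"
      by (simp add: restrict_def fun_eq_iff)
    also have "\<dots> = g" using g by (rule PiE_restrict)
    finally show "(\<lambda>A\<in>\<theta>. blocks_within A (\<Union>A\<in>\<theta>. g A)) = g" .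
  qed
  show "\<forall>\<sigma>\<in>{\<sigma> \<in> nc_partitions X. nc_le \<sigma> \<theta>}. (\<Union>A\<in>\<theta>. (\<lambda>A\<in>\<theta>. blocks_within A \<sigma>) A) = \<sigma>"
    using UN_blocks_within[OF nc_partitionsD(1) nc_partitionsD(1)[OF \<theta>]] by simp
  show "(\<lambda>g. \<Union>A\<in>\<theta>. g A) ` PiE \<theta> nc_partitions \<subseteq> {\<sigma> \<in> nc_partitions X. nc_le \<sigma> \<theta>}"
  proof (rule image_subsetI)
    fix g assume g: "g \<in> PiE \<theta> nc_partitions"
    show "(\<Union>A\<in>\<theta>. g A) \<in> {\<sigma> \<in> nc_partitions X. nc_le \<sigma> \<theta>}"
      using UN_nc_partitions(1,2)[OF \<theta> PiE_mem[OF g]] by simp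
  qed
  show "(\<lambda>\<sigma>. \<lambda>A\<in>\<theta>. blocks_within A \<sigma>) ` {\<sigma> \<in> nc_partitions X. nc_le \<sigma> \<theta>} \<subseteq> PiE \<theta> nc_partitions"
    using blocks_within_nc[OF _ nc_partitionsD(1)[OF \<theta>]]
    by (intro image_subsetI restrict_PiE_iff[THEN iffD2] ballI) simp
qed

text \<open>
  The relative Kreweras complement of \<open>\<sigma>\<close> in \<open>\<theta>\<close>: the permutation of \<open>\<theta>\<close> is the product of the cycles of its
  blocks, so the complement can be taken inside each block separately.
\<close>

definition kreweras_below :: "nat set set \<Rightarrow> nat set set \<Rightarrow> nat set set" where
  "kreweras_below \<theta> \<sigma> = (\<Union>A\<in>\<theta>. kreweras_on A (blocks_within A \<sigma>))"

lemma kreweras_on_nc: "\<sigma> \<in> nc_partitions A \<Longrightarrow> kreweras_on A \<sigma> \<in> nc_partitions A"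
  using noncrossing_kreweras_on[of A \<sigma> A]
  by (simp add: nc_partitions_def partition_on_kreweras_on)

lemma kreweras_below_nc:
  assumes "\<theta> \<in> nc_partitions X" "\<sigma> \<in> nc_partitions X" "nc_le \<sigma> \<theta>"
  shows "kreweras_below \<theta> \<sigma> \<in> nc_partitions X"
  unfolding kreweras_below_def
proof (rule UN_nc_partitions(1)[OF assms(1)])
  fix A assume "A \<in> \<theta>"
  then show "kreweras_on A (blocks_within A \<sigma>) \<in> nc_partitions A"
    by (intro kreweras_on_nc blocks_within_nc[OF assms(2) nc_partitionsD(1)[OF assms(1)] assms(3)])
qed

lemma block_perm_kreweras_below:
  assumes X: "finite X" and \<theta>: "\<theta> \<in> nc_partitions X" and \<sigma>: "\<sigma> \<in> nc_partitions X" "nc_le \<sigma> \<theta>"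
  shows "block_perm \<sigma> \<circ> block_perm (kreweras_below \<theta> \<sigma>) = block_perm \<theta>"
proof
  note p\<theta> = nc_partitionsD(1)[OF \<theta>] and p\<sigma> = nc_partitionsD(1)[OF \<sigma>(1)]
    and pK = nc_partitionsD(1)[OF kreweras_below_nc[OF \<theta> \<sigma>]]
  fix i
  show "(block_perm \<sigma> \<circ> block_perm (kreweras_below \<theta> \<sigma>)) i = block_perm \<theta> i"
  proof (cases "i \<in> X")
    case True
    then obtain A where A: "A \<in> \<theta>" "i \<in> A" using partition_on_obtain_block[OF p\<theta>] by blast
    define \<sigma>A where "\<sigma>A = blocks_within A \<sigma>"
    have \<sigma>A: "\<sigma>A \<in> nc_partitions A"
      unfolding \<sigma>A_def by (rule blocks_within_nc[OF \<sigma>(1) p\<theta> \<sigma>(2) A(1)])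
    have fin: "finite A" using partition_on_finite_block[OF p\<theta> X A(1)] .
    have "block_perm (kreweras_below \<theta> \<sigma>) i = block_perm (kreweras_on A \<sigma>A) i"
      by (rule block_perm_subpartition[OF pK partition_on_kreweras_on _ A(2), symmetric])
        (use A in \<open>auto simp: kreweras_below_def \<sigma>A_def\<close>)
    moreover have "block_perm \<sigma> j = block_perm \<sigma>A j" if "j \<in> A" for j
      by (rule block_perm_subpartition[OF p\<sigma> nc_partitionsD(1)[OF \<sigma>A] _ that, symmetric])
        (simp add: \<sigma>A_def blocks_within_subset)
    ultimately show ?thesis
      using block_perm_kreweras_on[OF fin \<sigma>A A(2)] block_perm_block[OF p\<theta> A] by simp
  next
    case False
    then show ?thesis using block_perm_outside p\<theta> p\<sigma> pK by simp
  qed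
qed

text \<open>
  This shows in particular that the definite description in \<open>rel_kreweras\<close> denotes a non-crossing
  partition whenever \<open>\<sigma> \<le> \<theta>\<close>.
\<close>

lemma rel_kreweras_eq:
  assumes \<theta>: "\<theta> \<in> NC n" and \<sigma>: "\<sigma> \<in> NC n" "nc_le \<sigma> \<theta>"
  shows "rel_kreweras n \<theta> \<sigma> = kreweras_below \<theta> \<sigma>"
  unfolding rel_kreweras_def
proof (rule the_equality)
  have bij: "bij (block_perm \<sigma>)"
    using bij_block_perm[of "{1..n}" \<sigma>] \<sigma> nc_partitionsD by (simp add: NC_eq)
  have iff: "block_perm \<tau> = inv (block_perm \<sigma>) \<circ> block_perm \<theta> \<longleftrightarrow>
      block_perm \<sigma> \<circ> block_perm \<tau> = block_perm \<theta>" for \<tau>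
    using bij by (metis bij_is_inj bij_is_surj comp_assoc comp_id id_comp inv_o_cancel surj_iff)
  have K: "kreweras_below \<theta> \<sigma> \<in> NC n"
    using kreweras_below_nc[OF \<theta>[unfolded NC_eq] \<sigma>[unfolded NC_eq]] by (simp add: NC_eq)
  moreover have KP: "block_perm (kreweras_below \<theta> \<sigma>) = inv (block_perm \<sigma>) \<circ> block_perm \<theta>"
    unfolding iff using block_perm_kreweras_below[of "{1..n}"] \<theta> \<sigma> by (simp add: NC_eq)
  ultimately show "kreweras_below \<theta> \<sigma> \<in> NC n \<and>
      block_perm (kreweras_below \<theta> \<sigma>) = inv (block_perm \<sigma>) \<circ> block_perm \<theta>" ..
  show "\<tau> = kreweras_below \<theta> \<sigma>"
    if "\<tau> \<in> NC n \<and> block_perm \<tau> = inv (block_perm \<sigma>) \<circ> block_perm \<theta>" for \<tau>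
    using block_perm_inject[of "{1..n}" \<tau> "kreweras_below \<theta> \<sigma>"] that K KP
    by (simp add: NC_def)
qed

lemma nc_zero_NC: "nc_zero n \<in> NC n"
  using partition_on_singletons[of "{1..n}"]
  unfolding NC_def nc_zero_def noncrossing_def by fastforce

lemma nc_one_NC: "n \<ge> 1 \<Longrightarrow> nc_one n \<in> NC n"
  by (simp add: NC_def nc_one_def noncrossing_def partition_on_space)

lemma nc_le_one:
  assumes "\<sigma> \<in> NC n"
  shows "nc_le \<sigma> (nc_one n)"
proof -
  have "{1..n} = \<Union>\<sigma>" using assms partition_onD1[of "{1..n}" \<sigma>] by (simp add: NC_def)
  then show ?thesis unfolding nc_le_def nc_one_def by blast
qed

lemma block_perm_nc_zero: "block_perm (nc_zero n) = id"
proof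
  fix i
  have part: "partition_on {1..n} (nc_zero n)" using nc_zero_NC by (simp add: NC_def)
  show "block_perm (nc_zero n) i = id i"
  proof (cases "i \<in> {1..n}")
    case True
    then have "block_perm (nc_zero n) i = cyclic_succ {i} i"
      by (intro block_perm_block[OF part]) (simp_all add: nc_zero_def)
    also have "\<dots> = i" by (simp add: cyclic_succ_def)
    finally show ?thesis by simp
  next
    case False
    then show ?thesis using block_perm_outside[OF part] by simp
  qed
qed

text \<open>
  The permutation of \<open>0\<^sub>n\<close> is the identity, so both sides say that \<open>\<sigma>\<close> and \<open>\<theta>\<close> have the same permutation.
\<close>

lemma rel_kreweras_eq_zero_iff:
  assumes "\<theta> \<in> NC n" "\<sigma> \<in> NC n" "nc_le \<sigma> \<theta>"
  shows "rel_kreweras n \<theta> \<sigma> = nc_zero n \<longleftrightarrow> \<sigma> = \<theta>"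
proof -
  have K: "kreweras_below \<theta> \<sigma> \<in> NC n" and
    perm: "block_perm \<sigma> \<circ> block_perm (kreweras_below \<theta> \<sigma>) = block_perm \<theta>"
    using kreweras_below_nc[OF assms[unfolded NC_eq]]
      block_perm_kreweras_below[OF _ assms[unfolded NC_eq]] by (simp_all add: NC_eq)
  note inject = block_perm_inject[of "{1..n}"]
  have "kreweras_below \<theta> \<sigma> = nc_zero n" if "\<sigma> = \<theta>"
  proof -
    have "inj (block_perm \<sigma>)"
      using bij_block_perm[of "{1..n}" \<sigma>] assms by (simp add: NC_def bij_is_inj)
    then have "block_perm (kreweras_below \<theta> \<sigma>) = block_perm (nc_zero n)"
      using perm that unfolding block_perm_nc_zero
      by (metis comp_apply eq_id_iff injD)
    then show ?thesis using inject K nc_zero_NC by (simp add: NC_def)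
  qed
  moreover have "\<sigma> = \<theta>" if "kreweras_below \<theta> \<sigma> = nc_zero n"
    using perm inject assms unfolding that block_perm_nc_zero by (simp add: NC_def)
  ultimately show ?thesis using rel_kreweras_eq[OF assms] by auto
qed

lemma kreweras_eq:
  assumes "\<sigma> \<in> NC n" "n \<ge> 1"
  shows "kreweras n \<sigma> = kreweras_on {1..n} \<sigma>"
proof -
  have "blocks_within {1..n} \<sigma> = \<sigma>"
    using assms(1) partition_on_block_subset[of "{1..n}" \<sigma>] by (auto simp: blocks_within_def NC_def)
  then show ?thesis
    unfolding kreweras_def rel_kreweras_eq[OF nc_one_NC[OF assms(2)] assms(1) nc_le_one[OF assms(1)]]
    by (simp add: kreweras_below_def nc_one_def)
qed

section \<open>Relabelling the elements of a block\<close>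

lemma strict_mono_on_le_iff:
  fixes e :: "nat \<Rightarrow> nat"
  assumes "strict_mono_on X e" "x \<in> X" "y \<in> X"
  shows "e x \<le> e y \<longleftrightarrow> x \<le> y" "e x < e y \<longleftrightarrow> x < y"
  by (rule strict_mono_on_less_eq[OF assms] strict_mono_on_less[OF assms])+

lemma nc_partitions_image:
  fixes e :: "nat \<Rightarrow> nat"
  assumes e: "strict_mono_on X e" and \<pi>: "\<pi> \<in> nc_partitions X"
  shows "(`) e ` \<pi> \<in> nc_partitions (e ` X)"
proof -
  note p = nc_partitionsD[OF \<pi>]
  have inj: "inj_on e X" using e by (rule strict_mono_on_imp_inj_on)
  have "partition_on (e ` X) ((`) e ` \<pi>)"
    using partition_on_inj_image[OF p(1) inj] partition_onD3[OF p(1)]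
    by (simp add: Diff_triv image_iff)
  moreover have "noncrossing ((`) e ` \<pi>)"
    unfolding noncrossing_def
  proof (intro ballI impI notI)
    fix B C assume BC: "B \<in> (`) e ` \<pi>" "C \<in> (`) e ` \<pi>" "B \<noteq> C"
      and "\<exists>a b c d. a < b \<and> b < c \<and> c < d \<and> a \<in> B \<and> c \<in> B \<and> b \<in> C \<and> d \<in> C"
    then obtain a' b' c' d' where
      cross: "a' < b'" "b' < c'" "c' < d'" "a' \<in> B" "c' \<in> B" "b' \<in> C" "d' \<in> C" by blast
    from BC obtain B' C' where *: "B' \<in> \<pi>" "C' \<in> \<pi>" "B = e ` B'" "C = e ` C'" "B' \<noteq> C'" by blast
    obtain a where a: "a' = e a" "a \<in> B'" using cross(4) *(3) by blast
    obtain b where b: "b' = e b" "b \<in> C'" using cross(6) *(4) by blast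
    obtain c where c: "c' = e c" "c \<in> B'" using cross(5) *(3) by blast
    obtain d where d: "d' = e d" "d \<in> C'" using cross(7) *(4) by blast
    have "a \<in> X" "b \<in> X" "c \<in> X" "d \<in> X"
      using a b c d partition_on_block_subset[OF p(1)] *(1,2) by blast+
    then have "a < b" "b < c" "c < d"
      using cross(1-3) strict_mono_on_le_iff(2)[OF e] by (simp_all add: a b c d)
    then have "B' = C'" using a(2) c(2) b(2) d(2) by (rule noncrossingD[OF p(2) *(1,2)])
    then show False using *(5) by contradiction
  qed
  ultimately show ?thesis by (simp add: nc_partitions_def)
qed

lemma bij_betw_nc_partitions_image:
  fixes e :: "nat \<Rightarrow> nat"
  assumes e: "strict_mono_on X e"
  shows "bij_betw ((`) ((`) e)) (nc_partitions X) (nc_partitions (e ` X))"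
proof -
  define d where "d = inv_into X e"
  have inj: "inj_on e X" using e by (rule strict_mono_on_imp_inj_on)
  have de: "d (e x) = x" if "x \<in> X" for x using inj that by (simp add: d_def)
  have d: "strict_mono_on (e ` X) d"
    by (rule strict_mono_onI) (auto simp: de strict_mono_on_le_iff(2)[OF e])
  have img: "d ` e ` X = X" using de by force
  have cancel: "(`) g ` (`) f ` \<pi> = \<pi>"
    if "partition_on Z \<pi>" "\<And>x. x \<in> Z \<Longrightarrow> g (f x) = x" for Z \<pi> and f g :: "nat \<Rightarrow> nat"
  proof -
    have "g ` f ` B = B" if "B \<in> \<pi>" for B
      using partition_on_block_subset[OF \<open>partition_on Z \<pi>\<close> that] \<open>\<And>x. x \<in> Z \<Longrightarrow> g (f x) = x\<close>
      by (force simp: image_image)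
    then show ?thesis by (simp add: image_image)
  qed
  show ?thesis
  proof (rule bij_betw_byWitness[where f' = "(`) ((`) d)"])
    show "\<forall>\<pi>\<in>nc_partitions X. (`) d ` (`) e ` \<pi> = \<pi>"
      using cancel de nc_partitionsD(1) by blast
    show "\<forall>\<pi>\<in>nc_partitions (e ` X). (`) e ` (`) d ` \<pi> = \<pi>"
    proof
      fix \<pi> assume "\<pi> \<in> nc_partitions (e ` X)"
      then show "(`) e ` (`) d ` \<pi> = \<pi>"
        by (intro cancel[of "e ` X"] nc_partitionsD(1)) (auto simp: de)
    qed
    show "(`) ((`) e) ` nc_partitions X \<subseteq> nc_partitions (e ` X)"
      using nc_partitions_image[OF e] by blast
    show "(`) ((`) d) ` nc_partitions (e ` X) \<subseteq> nc_partitions X"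
      using nc_partitions_image[OF d] unfolding img by blast
  qed
qed

lemma kreweras_on_image:
  fixes e :: "nat \<Rightarrow> nat"
  assumes e: "strict_mono_on X e" and \<sigma>: "partition_on X \<sigma>"
  shows "kreweras_on (e ` X) ((`) e ` \<sigma>) = (`) e ` kreweras_on X \<sigma>"
proof -
  have inj: "inj_on (map_prod e e) (X \<times> X)"
    using strict_mono_on_imp_inj_on[OF e] by (simp add: map_prod_inj_on)
  have sub: "separated_pairs \<sigma> i \<subseteq> X \<times> X" for i
    using partition_on_block_subset[OF \<sigma>] by (auto simp: separated_pairs_def)
  have img: "separated_pairs ((`) e ` \<sigma>) (e i) = map_prod e e ` separated_pairs \<sigma> i"
    if i: "i \<in> X" for i
  proof -
    have *: "(e x \<le> e i \<longleftrightarrow> e i < e y) \<longleftrightarrow> (x \<le> i \<longleftrightarrow> i < y)" if "B \<in> \<sigma>" "x \<in> B" "y \<in> B" for B x y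
      using strict_mono_on_le_iff[OF e] partition_on_block_subset[OF \<sigma>] that i by (metis subsetD)
    show ?thesis
    proof (intro set_eqI iffI)
      fix z assume "z \<in> separated_pairs ((`) e ` \<sigma>) (e i)"
      then obtain B x y where "B \<in> \<sigma>" "x \<in> B" "y \<in> B" "z = (e x, e y)" "e x \<le> e i \<longleftrightarrow> e i < e y"
        unfolding separated_pairs_def by blast
      then show "z \<in> map_prod e e ` separated_pairs \<sigma> i"
        using * by (auto simp: separated_pairs_def intro!: rev_image_eqI[of "(x, y)"])
    next
      fix z assume "z \<in> map_prod e e ` separated_pairs \<sigma> i"
      then obtain B x y where "B \<in> \<sigma>" "x \<in> B" "y \<in> B" "z = (e x, e y)" "x \<le> i \<longleftrightarrow> i < y"
        unfolding separated_pairs_def by auto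
      then show "z \<in> separated_pairs ((`) e ` \<sigma>) (e i)"
        using * unfolding separated_pairs_def by blast
    qed
  qed
  have "kreweras_block (e ` X) ((`) e ` \<sigma>) (e i) = e ` kreweras_block X \<sigma> i" if "i \<in> X" for i
    using that img inj_on_image_eq_iff[OF inj sub sub] by (auto simp: kreweras_block_def)
  then show ?thesis by (simp add: kreweras_on_def image_image)
qed

text \<open>
  The monotone bijection from \<open>A\<close> onto \<open>{1..card A}\<close>; it translates positions in a word \<open>w\<close> into positions
  in the subword \<open>w|A\<close>.
\<close>

definition rank :: "nat set \<Rightarrow> nat \<Rightarrow> nat" where
  "rank A a = card {x \<in> A. x \<le> a}"

lemma strict_mono_on_rank:
  assumes "finite A"
  shows "strict_mono_on A (rank A)"
proof (rule strict_mono_onI)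
  fix a b assume "a \<in> A" "b \<in> A" "a < b"
  then have "{x \<in> A. x \<le> a} \<subseteq> {x \<in> A. x \<le> b}" "b \<in> {x \<in> A. x \<le> b} - {x \<in> A. x \<le> a}" by auto
  then have "{x \<in> A. x \<le> a} \<subset> {x \<in> A. x \<le> b}" by blast
  then show "rank A a < rank A b" unfolding rank_def using assms by (intro psubset_card_mono) auto
qed

lemma rank_image:
  assumes "finite A"
  shows "rank A ` A = {1..card A}"
proof (rule card_subset_eq)
  show "rank A ` A \<subseteq> {1..card A}"
  proof
    fix r assume "r \<in> rank A ` A"
    then obtain a where a: "a \<in> A" "r = rank A a" by blast
    have "{a} \<subseteq> {x \<in> A. x \<le> a}" using a by auto
    then have "1 \<le> rank A a" unfolding rank_def using assms card_mono[of "{x \<in> A. x \<le> a}" "{a}"] by simp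
    moreover have "rank A a \<le> card A" unfolding rank_def using assms by (intro card_mono) auto
    ultimately show "r \<in> {1..card A}" using a by simp
  qed
  show "card (rank A ` A) = card {1..card A}"
    using card_image[OF strict_mono_on_imp_inj_on[OF strict_mono_on_rank[OF assms]]] by simp
qed simp

lemma length_restrict_word:
  assumes "A \<subseteq> {1..length w}"
  shows "length (restrict_word w A) = card A"
proof -
  have "A = Suc ` {i. i < length w \<and> Suc i \<in> A}"
  proof (intro set_eqI iffI)
    fix a assume a: "a \<in> A"
    then have "a \<in> {1..length w}" using assms by blast
    then show "a \<in> Suc ` {i. i < length w \<and> Suc i \<in> A}" using a by (cases a) auto
  qed auto
  then have "card A = card {i. i < length w \<and> Suc i \<in> A}"
    using card_image[OF inj_on_subset[OF inj_Suc subset_UNIV]] by metis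
  then show ?thesis by (simp add: restrict_word_def length_nths)
qed

text \<open>
  As 0 is not a position of a letter, the rank of \<open>a \<in> A\<close> counts precisely the letters up to position \<open>a\<close>
  that are kept in \<open>w|A\<close>.
\<close>

lemma restrict_word_rank:
  assumes "finite A" "0 \<notin> A" "B \<subseteq> A"
  shows "restrict_word (restrict_word w A) (rank A ` B) = restrict_word w B"
proof -
  have rank: "rank A (Suc i) = Suc (card {i'. Suc i' \<in> A \<and> i' < i})" if "Suc i \<in> A" for i
  proof -
    have "{x \<in> A. x \<le> Suc i} = insert (Suc i) (Suc ` {i'. Suc i' \<in> A \<and> i' < i})"
    proof (intro set_eqI iffI)
      fix x assume "x \<in> {x \<in> A. x \<le> Suc i}"
      then show "x \<in> insert (Suc i) (Suc ` {i'. Suc i' \<in> A \<and> i' < i})"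
        using assms(2) by (cases x) auto
    qed (use that in auto)
    then have "rank A (Suc i) = card (insert (Suc i) (Suc ` {i'. Suc i' \<in> A \<and> i' < i}))"
      by (simp only: rank_def)
    also have "\<dots> = Suc (card (Suc ` {i'. Suc i' \<in> A \<and> i' < i}))"
      by (rule card_insert_disjoint) auto
    also have "card (Suc ` {i'. Suc i' \<in> A \<and> i' < i}) = card {i'. Suc i' \<in> A \<and> i' < i}"
      by (rule card_image) simp
    finally show ?thesis .
  qed
  have "{i. Suc i \<in> A \<and> Suc (card {i'. Suc i' \<in> A \<and> i' < i}) \<in> rank A ` B} = {i. Suc i \<in> B}"
  proof (intro Collect_cong iffI conjI; (elim conjE)?)
    fix i assume i: "Suc i \<in> A" "Suc (card {i'. Suc i' \<in> A \<and> i' < i}) \<in> rank A ` B"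
    then have "rank A (Suc i) \<in> rank A ` B" using rank by simp
    then show "Suc i \<in> B"
      using i(1) assms(3) strict_mono_on_imp_inj_on[OF strict_mono_on_rank[OF assms(1)]]
      by (simp add: inj_on_image_mem_iff)
  next
    fix i assume "Suc i \<in> B"
    then show "Suc i \<in> A" "Suc (card {i'. Suc i' \<in> A \<and> i' < i}) \<in> rank A ` B"
      using assms(3) rank[of i, symmetric] by auto
  qed
  then show ?thesis by (simp add: restrict_word_def nths_nths)
qed

section \<open>The comultiplication on products of generators\<close>

lemma lookup_tensor [simp]:
  "Poly_Mapping.lookup (tensor a b) (m, m') = Poly_Mapping.lookup a m * Poly_Mapping.lookup b m'"
proof -
  have "Poly_Mapping.lookup (tensor a b) (m, m') =
      (\<Sum>i\<in>Poly_Mapping.keys a. \<Sum>j\<in>Poly_Mapping.keys b.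
        if j = m' then if i = m then Poly_Mapping.lookup a i * Poly_Mapping.lookup b j else 0 else 0)"
    by (simp add: tensor_def lookup_sum lookup_single when_def) (intro sum.cong refl, auto)
  also have "\<dots> = (\<Sum>i\<in>Poly_Mapping.keys a.
        if i = m then Poly_Mapping.lookup a i * Poly_Mapping.lookup b m' else 0)"
    by (intro sum.cong refl) (simp add: in_keys_iff)
  also have "\<dots> = Poly_Mapping.lookup a m * Poly_Mapping.lookup b m'"
    by (simp add: in_keys_iff)
  finally show ?thesis .
qed

lemma tensor_add_left: "tensor (a + a') b = tensor a b + tensor a' b"
  by (rule poly_mapping_eqI) (simp add: lookup_add algebra_simps split_paired_all)

lemma tensor_add_right: "tensor a (b + b') = tensor a b + tensor a b'"
  by (rule poly_mapping_eqI) (simp add: lookup_add algebra_simps split_paired_all)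

lemma tensor_zero [simp]: "tensor 0 b = 0" "tensor a 0 = 0"
  by (rule poly_mapping_eqI, simp add: split_paired_all)+

lemma tensor_single:
  "tensor (Poly_Mapping.single m x) (Poly_Mapping.single m' y) = Poly_Mapping.single (m, m') (x * y)"
  by (rule poly_mapping_eqI) (simp add: split_paired_all lookup_single when_def)

lemma tensor_one: "tensor 1 1 = 1"
  using tensor_single[of 0 1 0 1] by (simp add: zero_prod_def[symmetric])

lemma poly_mapping_additive_induct [case_names zero single add]:
  fixes p :: "'m \<Rightarrow>\<^sub>0 'b::comm_monoid_add"
  assumes "P 0" "\<And>m c. P (Poly_Mapping.single m c)" "\<And>p q. P p \<Longrightarrow> P q \<Longrightarrow> P (p + q)"
  shows "P p"
proof -
  have "P (\<Sum>m\<in>S. Poly_Mapping.single m (f m))" if "finite S" for S f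
    using that by (induction S) (simp_all add: assms)
  then show ?thesis
    using poly_mapping_decomp[of p] by (metis finite_keys)
qed

text \<open>
  Both sides are additive in each of the four arguments, and on monomials the equation is the
  multiplication of the product monoid.
\<close>

lemma tensor_mult: "tensor a b * tensor c d = tensor (a * c) (b * d)"
proof (induction a rule: poly_mapping_additive_induct)
  case (single m x)
  show ?case
  proof (induction b rule: poly_mapping_additive_induct)
    case (single m' y)
    show ?case
    proof (induction c rule: poly_mapping_additive_induct)
      case (single m'' z)
      show ?case
        by (induction d rule: poly_mapping_additive_induct)
          (simp_all add: tensor_single mult_single tensor_add_right distrib_left distrib_right mult_ac)
    qed (simp_all add: tensor_add_left distrib_left)
  qed (simp_all add: tensor_add_right distrib_right)
qed (simp_all add: tensor_add_left distrib_right)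

lemma prod_tensor: "(\<Prod>i\<in>I. tensor (a i) (b i)) = tensor (\<Prod>i\<in>I. a i) (\<Prod>i\<in>I. b i)"
  by (induction I rule: infinite_finite_induct) (simp_all add: tensor_one tensor_mult)

lemma unital_alg_hom_prod:
  fixes h :: "'a::comm_ring_1 \<Rightarrow> 'b::comm_ring_1"
  assumes "unital_alg_hom s t h"
  shows "h (\<Prod>i\<in>I. f i) = (\<Prod>i\<in>I. h (f i))"
  using assms by (induction I rule: infinite_finite_induct) (simp_all add: unital_alg_hom_def)

lemma comult_hom: "unital_alg_hom cscale cscale comult"
  using comult_spec by blast

lemma Y_short: "length w < 2 \<Longrightarrow> Y w = 1"
  by (simp add: Y_def)

lemma Y_part_rank_image:
  assumes \<pi>: "partition_on A \<pi>" and A: "finite A" "0 \<notin> A"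
  shows "Y_part (restrict_word w A) ((`) (rank A) ` \<pi>) = Y_part w \<pi>"
proof -
  note inj = strict_mono_on_imp_inj_on[OF strict_mono_on_rank[OF A(1)]]
  have sub: "B \<subseteq> A" if "B \<in> \<pi>" for B using partition_on_block_subset[OF \<pi> that] .
  have "inj_on ((`) (rank A)) \<pi>"
    using inj_on_image_eq_iff[OF inj sub sub] by (intro inj_onI) blast
  then have "Y_part (restrict_word w A) ((`) (rank A) ` \<pi>) =
      (\<Prod>B\<in>\<pi>. Y (restrict_word (restrict_word w A) (rank A ` B)))"
    by (simp add: Y_part_def prod.reindex)
  also have "\<dots> = Y_part w \<pi>"
    unfolding Y_part_def by (intro prod.cong refl) (simp add: restrict_word_rank[OF A sub])
  finally show ?thesis .
qed

lemma NC_1: "NC 1 = {{{1}}}"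
proof
  have "\<pi> = {{1}}" if "partition_on {1} \<pi>" for \<pi> :: "nat set set"
  proof -
    have "B = {1}" if "B \<in> \<pi>" for B
      using partition_on_block_subset[OF \<open>partition_on {1} \<pi>\<close> that]
        partition_on_block_nonempty[OF \<open>partition_on {1} \<pi>\<close> that] by blast
    moreover have "\<pi> \<noteq> {}" using that by (auto simp: partition_on_def)
    ultimately show ?thesis by blast
  qed
  then show "NC 1 \<subseteq> {{{1}}}" by (auto simp: NC_def)
  show "{{{1}}} \<subseteq> NC 1" using nc_zero_NC[of 1] by (simp add: nc_zero_def)
qed

text \<open>
  The formula that defines the comultiplication on generators also holds for words with a single letter,
  where it reads \<open>\<Delta>(1) = 1 \<otimes> 1\<close>. Singleton blocks then need no separate treatment.
\<close>

lemma comult_Y: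
  assumes "w \<noteq> []"
  shows "comult (Y w) =
    (\<Sum>\<pi>\<in>NC (length w). tensor (Y_part w \<pi>) (Y_part w (kreweras_on {1..length w} \<pi>)))"
proof (cases "length w \<ge> 2")
  case True
  then have "comult (Y w) =
    (\<Sum>\<pi>\<in>NC (length w). tensor (Y_part w \<pi>) (Y_part w (kreweras (length w) \<pi>)))"
    using comult_spec by blast
  also have "\<dots> = (\<Sum>\<pi>\<in>NC (length w). tensor (Y_part w \<pi>) (Y_part w (kreweras_on {1..length w} \<pi>)))"
    using True by (intro sum.cong refl) (simp add: kreweras_eq)
  finally show ?thesis .
next
  case False
  then have len: "length w = 1" using assms by (simp add: not_le less_2_cases_iff)
  have one: "Y_part w {{1}} = 1"
    using length_restrict_word[of "{1}" w] len by (simp add: Y_part_def Y_short)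
  have "kreweras_on {1..1} {{1}} \<in> NC 1"
    using kreweras_on_nc[of "{{1}}" "{1..1}"] NC_1 unfolding NC_eq by blast
  then have "kreweras_on {1..1} {{1}} = {{1}}" unfolding NC_1 by simp
  then show ?thesis
    unfolding len NC_1 using one len conjunct1[OF conjunct2[OF comult_hom[unfolded unital_alg_hom_def]]]
    by (simp add: tensor_one Y_short)
qed

text \<open>
  Relabelling by ranks turns the sum over \<open>NC (card A)\<close> into a sum over the non-crossing partitions of the
  set of positions \<open>A\<close>, whose blocks select subwords of \<open>w\<close> itself.
\<close>

lemma comult_Y_restrict_word:
  assumes A: "A \<subseteq> {1..length w}" "A \<noteq> {}"
  shows "comult (Y (restrict_word w A)) =
    (\<Sum>\<sigma>\<in>nc_partitions A. tensor (Y_part w \<sigma>) (Y_part w (kreweras_on A \<sigma>)))"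
proof -
  have fin: "finite A" "0 \<notin> A" using A finite_subset by auto
  note mono = strict_mono_on_rank[OF fin(1)] and img = rank_image[OF fin(1)]
  let ?v = "restrict_word w A"
  have len: "length ?v = card A" using A(1) by (rule length_restrict_word)
  then have "?v \<noteq> []" using A(2) fin by auto
  then have "comult (Y ?v) =
      (\<Sum>\<pi>\<in>nc_partitions (rank A ` A). tensor (Y_part ?v \<pi>) (Y_part ?v (kreweras_on (rank A ` A) \<pi>)))"
    using comult_Y[of ?v] by (simp add: len NC_eq img)
  also have "\<dots> = (\<Sum>\<sigma>\<in>nc_partitions A. tensor (Y_part ?v ((`) (rank A) ` \<sigma>))
      (Y_part ?v (kreweras_on (rank A ` A) ((`) (rank A) ` \<sigma>))))"
    by (rule sum.reindex_bij_betw[OF bij_betw_nc_partitions_image[OF mono], symmetric])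
  also have "\<dots> = (\<Sum>\<sigma>\<in>nc_partitions A. tensor (Y_part w \<sigma>) (Y_part w (kreweras_on A \<sigma>)))"
  proof (intro sum.cong refl)
    fix \<sigma> assume "\<sigma> \<in> nc_partitions A"
    then have "partition_on A \<sigma>" by (rule nc_partitionsD)
    then show "tensor (Y_part ?v ((`) (rank A) ` \<sigma>))
        (Y_part ?v (kreweras_on (rank A ` A) ((`) (rank A) ` \<sigma>))) =
      tensor (Y_part w \<sigma>) (Y_part w (kreweras_on A \<sigma>))"
      by (simp add: kreweras_on_image[OF mono] Y_part_rank_image fin partition_on_kreweras_on)
  qed
  finally show ?thesis .
qed

lemma Y_part_UN:
  assumes \<theta>: "partition_on X \<theta>" "finite X" and g: "\<And>A. A \<in> \<theta> \<Longrightarrow> partition_on A (g A)"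
  shows "Y_part w (\<Union>A\<in>\<theta>. g A) = (\<Prod>A\<in>\<theta>. Y_part w (g A))"
  unfolding Y_part_def
proof (rule prod.UNION_disjoint)
  show "finite \<theta>" using partition_on_finite[OF \<theta>] .
  show "\<forall>A\<in>\<theta>. finite (g A)"
    using partition_on_finite[OF g] partition_on_finite_block[OF \<theta>] by blast
  show "\<forall>A\<in>\<theta>. \<forall>A'\<in>\<theta>. A \<noteq> A' \<longrightarrow> g A \<inter> g A' = {}"
  proof (intro ballI impI equals0I)
    fix A A' B assume *: "A \<in> \<theta>" "A' \<in> \<theta>" "A \<noteq> A'" "B \<in> g A \<inter> g A'"
    then obtain i where "i \<in> B" using partition_on_block_nonempty[OF g] by blast
    then have "i \<in> A" "i \<in> A'" using * partition_on_block_subset[OF g] by blast+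
    then show False using partition_on_block_unique[OF \<theta>(1)] * by blast
  qed
qed

text \<open>
  Expanding the product of the sums \<open>\<Delta>(Y\<^bsub>w|A\<^esub>)\<close> gives a sum over the families of non-crossing partitions of
  the blocks \<open>A\<close> of \<open>\<theta>\<close>, that is, over all \<open>\<sigma> \<le> \<theta>\<close>.
\<close>

lemma comult_Y_part:
  assumes \<theta>: "\<theta> \<in> NC (length w)"
  shows "comult (Y_part w \<theta>) =
    (\<Sum>\<sigma> | \<sigma> \<in> NC (length w) \<and> nc_le \<sigma> \<theta>.
      tensor (Y_part w \<sigma>) (Y_part w (rel_kreweras (length w) \<theta> \<sigma>)))"
proof -
  let ?X = "{1..length w}"
  have \<theta>': "\<theta> \<in> nc_partitions ?X" using \<theta> by (simp add: NC_eq)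
  note part = nc_partitionsD(1)[OF \<theta>']
  have "comult (Y_part w \<theta>) = (\<Prod>A\<in>\<theta>. comult (Y (restrict_word w A)))"
    unfolding Y_part_def by (rule unital_alg_hom_prod[OF comult_hom])
  also have "\<dots> = (\<Prod>A\<in>\<theta>. \<Sum>\<sigma>\<in>nc_partitions A. tensor (Y_part w \<sigma>) (Y_part w (kreweras_on A \<sigma>)))"
    using partition_on_block_subset[OF part] partition_on_block_nonempty[OF part]
    by (intro prod.cong refl comult_Y_restrict_word)
  also have "\<dots> = (\<Sum>g\<in>PiE \<theta> nc_partitions.
      \<Prod>A\<in>\<theta>. tensor (Y_part w (g A)) (Y_part w (kreweras_on A (g A))))"
  proof (rule prod_sum_PiE)
    show "finite \<theta>" using partition_on_finite[OF part] by simp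
    show "finite (nc_partitions A)" if "A \<in> \<theta>" for A
      using partition_on_finite_block[OF part _ that] by (simp add: finite_nc_partitions)
  qed
  also have "\<dots> = (\<Sum>g\<in>PiE \<theta> nc_partitions. tensor (Y_part w (\<Union>A\<in>\<theta>. g A))
      (Y_part w (kreweras_below \<theta> (\<Union>A\<in>\<theta>. g A))))"
  proof (intro sum.cong refl)
    fix g assume g: "g \<in> PiE \<theta> nc_partitions"
    note gA = PiE_mem[OF g]
    have "kreweras_below \<theta> (\<Union>A\<in>\<theta>. g A) = (\<Union>A\<in>\<theta>. kreweras_on A (g A))"
      unfolding kreweras_below_def using UN_nc_partitions(3)[OF \<theta>' gA] by simp
    moreover have "Y_part w (\<Union>A\<in>\<theta>. g A) = (\<Prod>A\<in>\<theta>. Y_part w (g A))"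
      using nc_partitionsD(1)[OF gA] by (intro Y_part_UN[OF part]) auto
    moreover have "Y_part w (\<Union>A\<in>\<theta>. kreweras_on A (g A)) = (\<Prod>A\<in>\<theta>. Y_part w (kreweras_on A (g A)))"
      by (intro Y_part_UN[OF part] partition_on_kreweras_on) simp
    ultimately show "(\<Prod>A\<in>\<theta>. tensor (Y_part w (g A)) (Y_part w (kreweras_on A (g A)))) =
        tensor (Y_part w (\<Union>A\<in>\<theta>. g A)) (Y_part w (kreweras_below \<theta> (\<Union>A\<in>\<theta>. g A)))"
      by (simp add: prod_tensor)
  qed
  also have "\<dots> = (\<Sum>\<sigma> | \<sigma> \<in> nc_partitions ?X \<and> nc_le \<sigma> \<theta>.
      tensor (Y_part w \<sigma>) (Y_part w (kreweras_below \<theta> \<sigma>)))"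
    by (rule sum.reindex_bij_betw[OF bij_betw_blocks_within[OF \<theta>']])
  also have "\<dots> = (\<Sum>\<sigma> | \<sigma> \<in> NC (length w) \<and> nc_le \<sigma> \<theta>.
      tensor (Y_part w \<sigma>) (Y_part w (rel_kreweras (length w) \<theta> \<sigma>)))"
    by (intro sum.cong) (simp_all add: rel_kreweras_eq[OF \<theta>] NC_eq)
  finally show ?thesis .
qed

lemma unital_alg_hom_imp_linear: "unital_alg_hom cscale (*) h \<Longrightarrow> linear_functional h"
  by (simp add: unital_alg_hom_def linear_functional_def)

lemma linear_functional_sum:
  assumes "linear_functional \<phi>"
  shows "\<phi> (\<Sum>i\<in>I. f i) = (\<Sum>i\<in>I. \<phi> (f i))"
proof -
  interpret Vector_Spaces.linear cscale "(*)" \<phi> using assms by (simp add: linear_functional_def)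
  show ?thesis by (rule sum)
qed

lemma linear_functional_diff:
  assumes "linear_functional \<phi>" "linear_functional \<psi>"
  shows "linear_functional (\<lambda>p. \<phi> p - \<psi> p)"
proof -
  interpret f: Vector_Spaces.linear cscale "(*)" \<phi> using assms by (simp add: linear_functional_def)
  interpret g: Vector_Spaces.linear cscale "(*)" \<psi> using assms by (simp add: linear_functional_def)
  show ?thesis
    unfolding linear_functional_def
    by unfold_locales (simp_all add: f.add g.add f.scale g.scale algebra_simps)
qed

lemma linear_functional_convolution:
  "linear_functional (convolution \<xi> \<eta>)"
proof -
  interpret c: Vector_Spaces.linear cscale cscale comult
    by (rule conjunct1[OF comult_hom[unfolded unital_alg_hom_def]])
  interpret t: Vector_Spaces.linear cscale "(*)" "tensor_functional \<xi> \<eta>"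
    by (rule linear_tensor_functional[unfolded linear_functional_def])
  show ?thesis
    unfolding linear_functional_def
    by unfold_locales (simp_all add: convolution_def c.add t.add c.scale t.scale)
qed

lemma counit_hom: "unital_alg_hom cscale (*) counit"
  using counit_spec by blast

lemma linear_functional_conv_power: "linear_functional (conv_power \<xi> l)"
  by (cases l) (simp_all add: linear_functional_convolution unital_alg_hom_imp_linear counit_hom)

lemma convolution_Y_part:
  assumes "linear_functional \<xi>" "linear_functional \<eta>" "\<theta> \<in> NC (length w)"
  shows "convolution \<xi> \<eta> (Y_part w \<theta>) =
    (\<Sum>\<sigma> | \<sigma> \<in> NC (length w) \<and> nc_le \<sigma> \<theta>.
      \<xi> (Y_part w \<sigma>) * \<eta> (Y_part w (rel_kreweras (length w) \<theta> \<sigma>)))"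
  by (simp add: convolution_def comult_Y_part[OF assms(3)]
      linear_functional_sum[OF linear_tensor_functional] tensor_functional_tensor[OF assms(1,2)])

section \<open>The R-transform\<close>

lemma restrict_word_all: "restrict_word w {1..length w} = w"
  by (simp add: restrict_word_def nths_all)

lemma length_restrict_word_block:
  assumes "\<pi> \<in> NC (length w)" "B \<in> \<pi>"
  shows "length (restrict_word w B) = card B" "length (restrict_word w B) \<ge> 1"
proof -
  have part: "partition_on {1..length w} \<pi>" using assms by (simp add: NC_def)
  show "length (restrict_word w B) = card B"
    by (rule length_restrict_word) (rule partition_on_block_subset[OF part assms(2)])
  moreover have "finite B" using partition_on_finite_block[OF part _ assms(2)] by simp
  then have "card B \<noteq> 0" using partition_on_block_nonempty[OF part assms(2)] by simp
  ultimately show "length (restrict_word w B) \<ge> 1" by simp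
qed

lemma length_restrict_word_less:
  assumes "\<pi> \<in> NC (length w) - {nc_one (length w)}" "B \<in> \<pi>"
  shows "length (restrict_word w B) < length w"
proof -
  let ?X = "{1..length w}"
  have part: "partition_on ?X \<pi>" using assms by (simp add: NC_def)
  have sub: "B \<subseteq> ?X" by (rule partition_on_block_subset[OF part assms(2)])
  have "B \<noteq> ?X"
  proof
    assume B: "B = ?X"
    have "C = B" if C: "C \<in> \<pi>" for C
    proof -
      obtain i where "i \<in> C" using partition_on_block_nonempty[OF part C] by blast
      moreover have "i \<in> B" using \<open>i \<in> C\<close> partition_on_block_subset[OF part C] B by blast
      ultimately show ?thesis using partition_on_block_unique[OF part C assms(2)] by blast
    qed
    then have "\<pi> = nc_one (length w)" using assms(2) B unfolding nc_one_def by blast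
    then show False using assms(1) by simp
  qed
  then have "card B < card ?X" using sub by (intro psubset_card_mono) auto
  moreover have "length (restrict_word w B) = card B"
    using assms(1) by (intro length_restrict_word_block(1)[OF _ assms(2)]) simp
  ultimately show ?thesis by simp
qed

text \<open>
  Solving the moment-cumulant equation for the term of the one-block partition: all other terms
  only involve shorter words.
\<close>

function free_cumulant :: "('k list \<Rightarrow> complex) \<Rightarrow> 'k list \<Rightarrow> complex" where
  "free_cumulant M w = (if w = [] then 0 else
     M w - (\<Sum>\<pi>\<in>NC (length w) - {nc_one (length w)}. \<Prod>B\<in>\<pi>. free_cumulant M (restrict_word w B)))"
  by pat_completeness auto
termination
  by (relation "measure (\<lambda>(M, w). length w)") (simp_all add: length_restrict_word_less)

declare free_cumulant.simps [simp del]

lemma sum_NC_Cf_part: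
  assumes "w \<noteq> []"
  shows "(\<Sum>\<pi>\<in>NC (length w). Cf_part w \<pi> f) =
    f w + (\<Sum>\<pi>\<in>NC (length w) - {nc_one (length w)}. \<Prod>B\<in>\<pi>. f (restrict_word w B))"
proof -
  have "nc_one (length w) \<in> NC (length w)" using assms by (intro nc_one_NC) (simp add: Suc_le_eq)
  then have "(\<Sum>\<pi>\<in>NC (length w). Cf_part w \<pi> f) = Cf_part w (nc_one (length w)) f +
      (\<Sum>\<pi>\<in>NC (length w) - {nc_one (length w)}. Cf_part w \<pi> f)"
    by (rule sum.remove[OF finite_NC])
  moreover have "Cf_part w (nc_one (length w)) f = f w"
    using restrict_word_all[of w] by (simp add: Cf_part_def nc_one_def Cf_def)
  ultimately show ?thesis by (simp add: Cf_part_def Cf_def)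
qed

text \<open>
  The recursion of \<open>free_cumulant\<close> is equivalent to the moment-cumulant equations, and it has exactly one
  solution; so the definite description in \<open>R_transform\<close> denotes this solution.
\<close>

lemma R_transform_moment:
  assumes "w \<noteq> []"
  shows "\<mu> (prod_list (map ncX w)) = (\<Sum>\<pi>\<in>NC (length w). Cf_part w \<pi> (R_transform \<mu>))"
proof -
  define M where "M w = \<mu> (prod_list (map ncX w))" for w
  define P where "P f \<longleftrightarrow> f [] = 0 \<and> (\<forall>w. w \<noteq> [] \<longrightarrow> M w = (\<Sum>\<pi>\<in>NC (length w). Cf_part w \<pi> f))" for f
  have ex: "P (free_cumulant M)"
    unfolding P_def
  proof (intro conjI allI impI)
    show "free_cumulant M [] = 0" by (simp add: free_cumulant.simps)
    fix w :: "'a list" assume "w \<noteq> []"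
    then show "M w = (\<Sum>\<pi>\<in>NC (length w). Cf_part w \<pi> (free_cumulant M))"
      by (simp add: sum_NC_Cf_part free_cumulant.simps[of M w])
  qed
  have eq: "f w = free_cumulant M w" if f: "P f" for f w
  proof (induction w rule: length_induct)
    case (1 w)
    show ?case
    proof (cases "w = []")
      case True
      then show ?thesis using f by (simp add: P_def free_cumulant.simps)
    next
      case False
      have "M w = f w + (\<Sum>\<pi>\<in>NC (length w) - {nc_one (length w)}. \<Prod>B\<in>\<pi>. f (restrict_word w B))"
        using f False sum_NC_Cf_part[OF False, of f] by (simp add: P_def)
      also have "(\<Sum>\<pi>\<in>NC (length w) - {nc_one (length w)}. \<Prod>B\<in>\<pi>. f (restrict_word w B)) =
          (\<Sum>\<pi>\<in>NC (length w) - {nc_one (length w)}. \<Prod>B\<in>\<pi>. free_cumulant M (restrict_word w B))"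
        using 1 length_restrict_word_less by (intro sum.cong prod.cong refl) blast
      finally show ?thesis using False by (simp add: free_cumulant.simps[of M w])
    qed
  qed
  have "\<exists>!f. P f"
  proof (rule ex1I[of _ "free_cumulant M"])
    show "P (free_cumulant M)" by (rule ex)
    show "f = free_cumulant M" if "P f" for f using eq[OF that] by (rule ext)
  qed
  then have "P (THE f. P f)" by (rule theI')
  also have "(THE f. P f) = R_transform \<mu>" by (simp add: R_transform_def P_def M_def)
  finally show ?thesis using assms by (simp add: P_def M_def)
qed

lemma R_transform_letter:
  assumes "\<mu> \<in> Gk"
  shows "R_transform \<mu> [i] = 1"
proof -
  have "\<mu> (ncX i) = Cf_part [i] {{1}} (R_transform \<mu>)"
    using R_transform_moment[of "[i]" \<mu>] NC_1 by simp
  also have "\<dots> = R_transform \<mu> [i]"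
    using restrict_word_all[of "[i]"] by (simp add: Cf_part_def Cf_def)
  finally show ?thesis using assms by (simp add: Gk_def)
qed

section \<open>The values of the counit and the character on products of generators\<close>

lemma chi_hom: "unital_alg_hom cscale (*) (chi \<mu>)"
  using chi_spec by blast

text \<open>
  For blocks with a single element, \<open>Y\<close> is 1 by convention; the corresponding coefficient of \<open>R\<^sub>\<mu>\<close> is 1
  because \<open>\<mu>(X\<^sub>i) = 1\<close>. This is where the membership of \<open>\<mu>\<close> in \<open>Gk\<close> enters.
\<close>

lemma chi_Y_part:
  assumes "\<mu> \<in> Gk" "\<pi> \<in> NC (length w)"
  shows "chi \<mu> (Y_part w \<pi>) = Cf_part w \<pi> (R_transform \<mu>)"
proof -
  have "chi \<mu> (Y v) = R_transform \<mu> v" if v: "length v \<ge> 1" for v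
  proof (cases "length v \<ge> 2")
    case True
    then show ?thesis using conjunct2[OF chi_spec[of \<mu>]] by (simp add: Cf_def)
  next
    case False
    then have "length v = 1" using v by simp
    then obtain i where "v = [i]" by (auto simp: length_Suc_conv)
    moreover have "chi \<mu> 1 = 1" using chi_hom[of \<mu>] by (simp add: unital_alg_hom_def)
    ultimately show ?thesis using R_transform_letter[OF assms(1)] by (simp add: Y_short)
  qed
  then have "chi \<mu> (Y (restrict_word w B)) = R_transform \<mu> (restrict_word w B)" if "B \<in> \<pi>" for B
    using length_restrict_word_block(2)[OF assms(2) that] by blast
  then show ?thesis
    by (simp add: Y_part_def Cf_part_def Cf_def unital_alg_hom_prod[OF chi_hom])
qed

lemma Y_part_nc_zero: "Y_part w (nc_zero (length w)) = 1"
  unfolding Y_part_def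
proof (rule prod.neutral, rule ballI)
  fix B assume B: "B \<in> nc_zero (length w)"
  then have "card B = 1" by (auto simp: nc_zero_def)
  then show "Y (restrict_word w B) = 1"
    using length_restrict_word_block(1)[OF nc_zero_NC B] by (intro Y_short) simp
qed

lemma counit_Y_part:
  assumes "\<pi> \<in> NC (length w)"
  shows "counit (Y_part w \<pi>) = (if \<pi> = nc_zero (length w) then 1 else 0)"
proof (cases "\<forall>B\<in>\<pi>. card B < 2")
  case True
  have part: "partition_on {1..length w} \<pi>" using assms by (simp add: NC_def)
  have single: "B = {i}" if "B \<in> \<pi>" "i \<in> B" for B i
  proof -
    have "card B = 1" using True that length_restrict_word_block[OF assms that(1)] by force
    then show ?thesis using that(2) by (auto simp: card_1_singleton_iff)
  qed
  have "\<pi> = nc_zero (length w)"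
  proof (intro set_eqI iffI)
    fix B assume B: "B \<in> \<pi>"
    then obtain i where i: "i \<in> B" using partition_on_block_nonempty[OF part] by blast
    then show "B \<in> nc_zero (length w)"
      using single[OF B i] partition_on_block_subset[OF part B] by (auto simp: nc_zero_def)
  next
    fix B assume "B \<in> nc_zero (length w)"
    then obtain i where i: "i \<in> {1..length w}" "B = {i}" by (auto simp: nc_zero_def)
    then obtain C where C: "C \<in> \<pi>" "i \<in> C" using partition_on_obtain_block[OF part] by blast
    then show "B \<in> \<pi>" using single[OF C] i by simp
  qed
  moreover have "counit (1 :: 'a yalg) = 1"
    by (rule conjunct1[OF conjunct2[OF counit_hom[unfolded unital_alg_hom_def]]])
  ultimately show ?thesis by (simp add: Y_part_nc_zero)
next
  case False
  then obtain B where B: "B \<in> \<pi>" "card B \<ge> 2" by force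
  then have "counit (Y (restrict_word w B)) = 0"
    using counit_spec length_restrict_word_block(1)[OF assms B(1)] by metis
  moreover have "finite \<pi>"
    using partition_on_finite[of "{1..length w}" \<pi>] assms by (simp add: NC_def)
  ultimately have "counit (Y_part w \<pi>) = 0"
    unfolding Y_part_def unital_alg_hom_prod[OF counit_hom] using B(1) by (metis prod_zero)
  moreover have "\<pi> \<noteq> nc_zero (length w)"
    using B by (auto simp: nc_zero_def)
  ultimately show ?thesis by simp
qed

section \<open>Chains\<close>

text \<open>
  Chains with \<open>l\<close> steps from \<open>0\<^sub>n\<close> to an arbitrary \<open>\<theta>\<close>; this generality is needed to build up chains by
  appending their last element.
\<close>

definition nc_chains_to :: "nat \<Rightarrow> nat set set \<Rightarrow> nat \<Rightarrow> nat set set list set" where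
  "nc_chains_to n \<theta> l =
     {\<Gamma>. length \<Gamma> = Suc l \<and> set \<Gamma> \<subseteq> NC n \<and> hd \<Gamma> = nc_zero n \<and> last \<Gamma> = \<theta> \<and>
          (\<forall>j. Suc j < length \<Gamma> \<longrightarrow> nc_less (\<Gamma> ! j) (\<Gamma> ! Suc j))}"

lemma nc_chains_length_eq: "{\<Gamma> \<in> nc_chains n. chain_length \<Gamma> = l} = nc_chains_to n (nc_one n) l"
proof -
  have "\<Gamma> \<noteq> [] \<and> length \<Gamma> - 1 = l \<longleftrightarrow> length \<Gamma> = Suc l" for \<Gamma> :: "nat set set list"
    by (cases \<Gamma>) auto
  then show ?thesis
    unfolding nc_chains_def nc_chains_to_def chain_length_def by blast
qed

lemma finite_nc_chains_to: "finite (nc_chains_to n \<theta> l)"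
  by (rule finite_subset[OF _ finite_lists_length_eq[OF finite_NC[of n], of "Suc l"]])
    (auto simp: nc_chains_to_def)

lemma nc_chains_to_0:
  assumes "\<theta> \<in> NC n"
  shows "nc_chains_to n \<theta> 0 = (if \<theta> = nc_zero n then {[nc_zero n]} else {})"
  using assms by (auto simp: nc_chains_to_def length_Suc_conv)

lemma nc_chains_to_snoc:
  assumes "\<theta> \<in> NC n" "\<sigma> \<in> NC n" "nc_less \<sigma> \<theta>" "\<Gamma> \<in> nc_chains_to n \<sigma> l"
  shows "\<Gamma> @ [\<theta>] \<in> nc_chains_to n \<theta> (Suc l)"
proof -
  have \<Gamma>: "length \<Gamma> = Suc l" "last \<Gamma> = \<sigma>" "\<Gamma> \<noteq> []" using assms(4) by (auto simp: nc_chains_to_def)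
  have "nc_less ((\<Gamma> @ [\<theta>]) ! j) ((\<Gamma> @ [\<theta>]) ! Suc j)" if "Suc j < length (\<Gamma> @ [\<theta>])" for j
  proof (cases "Suc j < length \<Gamma>")
    case True
    then show ?thesis using assms(4) by (simp add: nc_chains_to_def nth_append)
  next
    case False
    then have "j = l" using that \<Gamma> by simp
    then show ?thesis using assms(3) \<Gamma> by (simp add: nth_append last_conv_nth)
  qed
  then show ?thesis using assms \<Gamma> by (simp add: nc_chains_to_def)
qed

lemma nc_chains_to_butlast:
  assumes "\<Gamma> \<in> nc_chains_to n \<theta> (Suc l)"
  obtains \<sigma> where "\<sigma> \<in> NC n" "nc_less \<sigma> \<theta>" "butlast \<Gamma> \<in> nc_chains_to n \<sigma> l"
    "last (butlast \<Gamma>) = \<sigma>" "\<Gamma> = butlast \<Gamma> @ [\<theta>]"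
proof -
  have len: "length \<Gamma> = Suc (Suc l)" and last: "last \<Gamma> = \<theta>" and NC: "set \<Gamma> \<subseteq> NC n"
    and hd: "hd \<Gamma> = nc_zero n"
    and less: "\<And>j. Suc j < length \<Gamma> \<Longrightarrow> nc_less (\<Gamma> ! j) (\<Gamma> ! Suc j)"
    using assms by (auto simp: nc_chains_to_def)
  define \<Delta> where "\<Delta> = butlast \<Gamma>"
  have "\<Gamma> \<noteq> []" using len by auto
  then have \<Gamma>: "\<Gamma> = \<Delta> @ [\<theta>]" using last by (metis \<Delta>_def append_butlast_last_id)
  have len': "length \<Delta> = Suc l" using len by (simp add: \<Delta>_def)
  then have ne: "\<Delta> \<noteq> []" by auto
  have "nc_less (\<Delta> ! j) (\<Delta> ! Suc j)" if "Suc j < length \<Delta>" for j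
    using less[of j] that by (simp add: \<Gamma> nth_append)
  moreover have "hd \<Delta> = nc_zero n" using hd ne by (simp add: \<Gamma>)
  ultimately have "\<Delta> \<in> nc_chains_to n (last \<Delta>) l"
    using NC len' by (auto simp: nc_chains_to_def \<Gamma>)
  moreover have "nc_less (last \<Delta>) \<theta>"
    using less[of l] len' ne by (simp add: \<Gamma> nth_append last_conv_nth)
  moreover have "last \<Delta> \<in> NC n" using NC ne by (simp add: \<Gamma> subset_iff)
  ultimately show ?thesis using that \<Gamma> unfolding \<Delta>_def by blast
qed

lemma Cf_chain_snoc:
  assumes "\<Gamma> \<noteq> []"
  shows "Cf_chain w (\<Gamma> @ [\<theta>]) f =
    Cf_chain w \<Gamma> f * Cf_part w (rel_kreweras (length w) \<theta> (last \<Gamma>)) f"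
proof -
  obtain l where l: "length \<Gamma> = Suc l" using assms by (cases \<Gamma>) auto
  have "(\<Prod>j=1..l. Cf_part w (rel_kreweras (length w) ((\<Gamma> @ [\<theta>]) ! j) ((\<Gamma> @ [\<theta>]) ! (j - 1))) f) =
      (\<Prod>j=1..l. Cf_part w (rel_kreweras (length w) (\<Gamma> ! j) (\<Gamma> ! (j - 1))) f)"
    using l by (intro prod.cong refl) (auto simp: nth_append)
  then show ?thesis
    using l assms by (simp add: Cf_chain_def chain_length_def nth_append last_conv_nth)
qed

lemma sum_nc_chains_to_Suc:
  fixes h :: "nat set set list \<Rightarrow> 'a::comm_monoid_add"
  assumes "\<theta> \<in> NC n"
  shows "(\<Sum>\<Gamma>\<in>nc_chains_to n \<theta> (Suc l). h \<Gamma>) =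
    (\<Sum>\<sigma> | \<sigma> \<in> NC n \<and> nc_less \<sigma> \<theta>. \<Sum>\<Gamma>\<in>nc_chains_to n \<sigma> l. h (\<Gamma> @ [\<theta>]))"
proof -
  have "(\<Sum>\<sigma> | \<sigma> \<in> NC n \<and> nc_less \<sigma> \<theta>. \<Sum>\<Gamma>\<in>nc_chains_to n \<sigma> l. h (\<Gamma> @ [\<theta>])) =
      (\<Sum>(\<sigma>, \<Gamma>)\<in>(SIGMA \<sigma>:{\<sigma> \<in> NC n. nc_less \<sigma> \<theta>}. nc_chains_to n \<sigma> l). h (\<Gamma> @ [\<theta>]))"
    by (rule sum.Sigma) (auto simp: finite_NC finite_nc_chains_to)
  also have "\<dots> = (\<Sum>\<Gamma>\<in>nc_chains_to n \<theta> (Suc l). h \<Gamma>)"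
  proof (rule sum.reindex_bij_witness[where i = "\<lambda>\<Gamma>. (last (butlast \<Gamma>), butlast \<Gamma>)"
        and j = "\<lambda>(\<sigma>, \<Gamma>). \<Gamma> @ [\<theta>]"])
    fix p assume p: "p \<in> (SIGMA \<sigma>:{\<sigma> \<in> NC n. nc_less \<sigma> \<theta>}. nc_chains_to n \<sigma> l)"
    then obtain \<sigma> \<Gamma> where *: "p = (\<sigma>, \<Gamma>)" "\<sigma> \<in> NC n" "nc_less \<sigma> \<theta>" "\<Gamma> \<in> nc_chains_to n \<sigma> l"
      by blast
    moreover have "last \<Gamma> = \<sigma>" using *(4) by (simp add: nc_chains_to_def)
    ultimately show "(last (butlast (case p of (\<sigma>, \<Gamma>) \<Rightarrow> \<Gamma> @ [\<theta>])),
        butlast (case p of (\<sigma>, \<Gamma>) \<Rightarrow> \<Gamma> @ [\<theta>])) = p"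
      by simp
    show "(case p of (\<sigma>, \<Gamma>) \<Rightarrow> \<Gamma> @ [\<theta>]) \<in> nc_chains_to n \<theta> (Suc l)"
      using nc_chains_to_snoc[OF assms *(2-4)] *(1) by simp
    show "h (case p of (\<sigma>, \<Gamma>) \<Rightarrow> \<Gamma> @ [\<theta>]) = (case p of (\<sigma>, \<Gamma>) \<Rightarrow> h (\<Gamma> @ [\<theta>]))"
      using *(1) by simp
  next
    fix \<Gamma> assume "\<Gamma> \<in> nc_chains_to n \<theta> (Suc l)"
    then obtain \<sigma> where *: "\<sigma> \<in> NC n" "nc_less \<sigma> \<theta>" "butlast \<Gamma> \<in> nc_chains_to n \<sigma> l"
      "last (butlast \<Gamma>) = \<sigma>" "\<Gamma> = butlast \<Gamma> @ [\<theta>]"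
      by (rule nc_chains_to_butlast)
    then show "(case (last (butlast \<Gamma>), butlast \<Gamma>) of (\<sigma>, \<Gamma>) \<Rightarrow> \<Gamma> @ [\<theta>]) = \<Gamma>" by simp
    show "(last (butlast \<Gamma>), butlast \<Gamma>) \<in> (SIGMA \<sigma>:{\<sigma> \<in> NC n. nc_less \<sigma> \<theta>}. nc_chains_to n \<sigma> l)"
      using *(1-4) by simp
  qed
  finally show ?thesis by (rule sym)
qed

lemma nc_le_trans:
  assumes "\<pi> \<in> NC n" "\<rho> \<in> NC n" "\<tau> \<in> NC n" "nc_le \<pi> \<rho>" "nc_le \<rho> \<tau>"
  shows "nc_le \<pi> \<tau>"
proof -
  have p: "partition_on {1..n} \<pi>" "partition_on {1..n} \<rho>" "partition_on {1..n} \<tau>"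
    using assms by (simp_all add: NC_def)
  show ?thesis
    using assms(4,5) unfolding nc_le_iff[OF p(1,2)] nc_le_iff[OF p(2,3)] nc_le_iff[OF p(1,3)]
    by (meson subset_trans)
qed

lemma nc_le_antisym:
  assumes "\<pi> \<in> NC n" "\<rho> \<in> NC n" "nc_le \<pi> \<rho>" "nc_le \<rho> \<pi>"
  shows "\<pi> = \<rho>"
proof -
  have sub: "\<pi> \<subseteq> \<rho>" if NC: "\<pi> \<in> NC n" "\<rho> \<in> NC n" and le: "nc_le \<pi> \<rho>" "nc_le \<rho> \<pi>" for \<pi> \<rho>
  proof
    have p: "partition_on {1..n} \<pi>" "partition_on {1..n} \<rho>" using NC by (simp_all add: NC_def)
    fix B assume B: "B \<in> \<pi>"
    then obtain A where A: "A \<in> \<rho>" "B \<subseteq> A" using le(1) unfolding nc_le_iff[OF p] by blast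
    then obtain C where C: "C \<in> \<pi>" "A \<subseteq> C" using le(2) unfolding nc_le_iff[OF p(2,1)] by blast
    obtain i where "i \<in> B" using partition_on_block_nonempty[OF p(1) B] by blast
    then have "B = C" using partition_on_block_unique[OF p(1) B C(1)] A C by blast
    then show "B \<in> \<rho>" using A C by (metis subset_antisym)
  qed
  show ?thesis using sub[OF assms] sub[OF assms(2,1,4,3)] by (rule subset_antisym)
qed

text \<open>
  A chain has pairwise distinct members, so its length is bounded. Consequently only finitely many
  terms of the logarithm series are non-zero.
\<close>

lemma nc_chains_to_length_less:
  assumes "\<Gamma> \<in> nc_chains_to n \<theta> l"
  shows "l < card (NC n)"
proof -
  define less where "less \<pi> \<rho> \<longleftrightarrow> \<pi> \<in> NC n \<and> \<rho> \<in> NC n \<and> nc_less \<pi> \<rho>" for \<pi> \<rho>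
  have len: "length \<Gamma> = Suc l" and NC: "set \<Gamma> \<subseteq> NC n"
    and step: "\<And>j. Suc j < length \<Gamma> \<Longrightarrow> nc_less (\<Gamma> ! j) (\<Gamma> ! Suc j)"
    using assms by (auto simp: nc_chains_to_def)
  have trans: "transp less"
  proof (rule transpI)
    fix x y z assume *: "less x y" "less y z"
    then have "nc_le x z" using nc_le_trans[of x n y z] by (simp add: less_def nc_less_def)
    moreover have "x \<noteq> z" using * nc_le_antisym[of x n y] by (auto simp: less_def nc_less_def)
    ultimately show "less x z" using * by (simp add: less_def nc_less_def)
  qed
  have "less (\<Gamma> ! j) (\<Gamma> ! Suc j)" if "Suc j < length \<Gamma>" for j
    using that step[OF that] NC nth_mem[of j \<Gamma>] nth_mem[OF that] by (auto simp: less_def)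
  then have "sorted_wrt less \<Gamma>" using sorted_wrt_iff_nth_Suc_transp[OF trans] by blast
  then have ne: "\<Gamma> ! i \<noteq> \<Gamma> ! j" if "i < j" "j < length \<Gamma>" for i j
    using sorted_wrt_nth_less[of less \<Gamma> i j] that by (auto simp: less_def nc_less_def)
  have "distinct \<Gamma>"
    unfolding distinct_conv_nth using ne by (metis linorder_neq_iff)
  then have "Suc l = card (set \<Gamma>)" using len by (simp add: distinct_card)
  also have "\<dots> \<le> card (NC n)" using NC by (rule card_mono[OF finite_NC])
  finally show ?thesis by simp
qed

section \<open>Powers of the counit minus the character\<close>

text \<open>
  The last convolution factor removes the last step \<open>\<sigma> < \<theta>\<close> of a chain and contributes its factor
  \<open>-Cf\<close>. The remaining factors are evaluated at \<open>Y\<^bsub>w;\<sigma>\<^esub>\<close>, which is why the statement concerns all \<open>\<theta>\<close>.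
\<close>

lemma conv_power_Y_part:
  assumes "\<mu> \<in> Gk" "\<theta> \<in> NC (length w)"
  shows "conv_power (\<lambda>q. counit q - chi \<mu> q) l (Y_part w \<theta>) =
    (-1) ^ l * (\<Sum>\<Gamma>\<in>nc_chains_to (length w) \<theta> l. Cf_chain w \<Gamma> (R_transform \<mu>))"
  using assms(2)
proof (induction l arbitrary: \<theta>)
  case 0
  then show ?case
    by (simp add: nc_chains_to_0 counit_Y_part Cf_chain_def chain_length_def)
next
  case (Suc l)
  let ?n = "length w" and ?R = "R_transform \<mu>" and ?\<delta> = "\<lambda>q. counit q - chi \<mu> q"
  have lin: "linear_functional ?\<delta>"
    by (intro linear_functional_diff unital_alg_hom_imp_linear counit_hom chi_hom)
  have \<delta>: "?\<delta> (Y_part w \<tau>) = (if \<tau> = nc_zero ?n then 0 else - Cf_part w \<tau> ?R)"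
    if "\<tau> \<in> NC ?n" for \<tau>
  proof -
    have "chi \<mu> 1 = 1" using chi_hom[of \<mu>] by (simp add: unital_alg_hom_def)
    then show ?thesis
      using counit_Y_part[OF that] chi_Y_part[OF assms(1) that] Y_part_nc_zero[of w] by auto
  qed
  have K: "?\<delta> (Y_part w (rel_kreweras ?n \<theta> \<sigma>)) =
      (if \<sigma> = \<theta> then 0 else - Cf_part w (rel_kreweras ?n \<theta> \<sigma>) ?R)"
    if "\<sigma> \<in> NC ?n" "nc_le \<sigma> \<theta>" for \<sigma>
  proof -
    have "rel_kreweras ?n \<theta> \<sigma> \<in> NC ?n"
      using kreweras_below_nc[of \<theta> "{1..?n}" \<sigma>] rel_kreweras_eq[OF Suc.prems that] Suc.prems that
      by (simp add: NC_eq)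
    then show ?thesis using \<delta> rel_kreweras_eq_zero_iff[OF Suc.prems that] by simp
  qed
  have "conv_power ?\<delta> (Suc l) (Y_part w \<theta>) =
      (\<Sum>\<sigma> | \<sigma> \<in> NC ?n \<and> nc_le \<sigma> \<theta>.
        conv_power ?\<delta> l (Y_part w \<sigma>) * ?\<delta> (Y_part w (rel_kreweras ?n \<theta> \<sigma>)))"
    using convolution_Y_part[OF linear_functional_conv_power lin Suc.prems] by simp
  \<comment> \<open>The term for \<open>\<sigma> = \<theta>\<close> vanishes, which makes the chains strict.\<close>
  also have "\<dots> = (\<Sum>\<sigma> | \<sigma> \<in> NC ?n \<and> nc_less \<sigma> \<theta>.
        conv_power ?\<delta> l (Y_part w \<sigma>) * - Cf_part w (rel_kreweras ?n \<theta> \<sigma>) ?R)"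
    by (rule sum.mono_neutral_cong_right) (auto simp: finite_NC nc_less_def K)
  also have "\<dots> = (\<Sum>\<sigma> | \<sigma> \<in> NC ?n \<and> nc_less \<sigma> \<theta>.
        (-1) ^ Suc l * (\<Sum>\<Gamma>\<in>nc_chains_to ?n \<sigma> l. Cf_chain w (\<Gamma> @ [\<theta>]) ?R))"
  proof (intro sum.cong refl)
    fix \<sigma> assume \<sigma>: "\<sigma> \<in> {\<sigma> \<in> NC ?n. nc_less \<sigma> \<theta>}"
    have "Cf_chain w (\<Gamma> @ [\<theta>]) ?R = Cf_chain w \<Gamma> ?R * Cf_part w (rel_kreweras ?n \<theta> \<sigma>) ?R"
      if "\<Gamma> \<in> nc_chains_to ?n \<sigma> l" for \<Gamma>
      using that Cf_chain_snoc[of \<Gamma> w \<theta> ?R] by (force simp: nc_chains_to_def)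
    then have "(\<Sum>\<Gamma>\<in>nc_chains_to ?n \<sigma> l. Cf_chain w (\<Gamma> @ [\<theta>]) ?R) =
        (\<Sum>\<Gamma>\<in>nc_chains_to ?n \<sigma> l. Cf_chain w \<Gamma> ?R) * Cf_part w (rel_kreweras ?n \<theta> \<sigma>) ?R"
      by (simp add: sum_distrib_right)
    then show "conv_power ?\<delta> l (Y_part w \<sigma>) * - Cf_part w (rel_kreweras ?n \<theta> \<sigma>) ?R =
        (-1) ^ Suc l * (\<Sum>\<Gamma>\<in>nc_chains_to ?n \<sigma> l. Cf_chain w (\<Gamma> @ [\<theta>]) ?R)"
      using Suc.IH[of \<sigma>] \<sigma> by simp
  qed
  also have "\<dots> = (-1) ^ Suc l * (\<Sum>\<Gamma>\<in>nc_chains_to ?n \<theta> (Suc l). Cf_chain w \<Gamma> ?R)"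
    by (simp only: sum_nc_chains_to_Suc[OF Suc.prems] sum_distrib_left)
  finally show ?case .
qed

lemma Y_part_nc_one: "Y_part w (nc_one (length w)) = Y w"
  using restrict_word_all[of w] by (simp add: Y_part_def nc_one_def)

theorem theorem1p6:
  fixes \<mu> :: "'k::finite ncpoly \<Rightarrow> complex" and w :: "'k list" and n :: nat
  assumes "\<mu> \<in> Gk" and "length w = n" and "n \<ge> 2"
  shows "Cf w (LS_transform \<mu>) = conv_log (chi \<mu>) (Y w) \<and>
    conv_log (chi \<mu>) (Y w) =
      (\<Sum>\<Gamma>\<in>nc_chains n.
         (-1) ^ (1 + chain_length \<Gamma>) / of_nat (chain_length \<Gamma>) * Cf_chain w \<Gamma> (R_transform \<mu>))"
proof
  show "Cf w (LS_transform \<mu>) = conv_log (chi \<mu>) (Y w)"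
    using assms by (simp add: Cf_def LS_transform_def)
  let ?R = "R_transform \<mu>" and ?N = "card (NC n)"
  let ?t = "\<lambda>\<Gamma>. (-1) ^ (1 + chain_length \<Gamma>) / of_nat (chain_length \<Gamma>) * Cf_chain w \<Gamma> ?R"
  let ?C = "\<lambda>l. {\<Gamma> \<in> nc_chains n. chain_length \<Gamma> = l}"
  have range: "chain_length \<Gamma> \<in> {1..?N}" if \<Gamma>: "\<Gamma> \<in> nc_chains n" for \<Gamma>
  proof -
    have \<Gamma>': "\<Gamma> \<in> nc_chains_to n (nc_one n) (chain_length \<Gamma>)"
      using \<Gamma> nc_chains_length_eq by blast
    \<comment> \<open>A chain of length 0 would require \<open>0\<^sub>n = 1\<^sub>n\<close>, which is excluded by \<open>n \<ge> 2\<close>.\<close>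
    have "nc_one n \<noteq> nc_zero n"
    proof
      assume "nc_one n = nc_zero n"
      then have "{1} \<in> nc_one n" using assms(3) by (auto simp: nc_zero_def)
      then have "{1} = {1..n}" by (simp add: nc_one_def)
      then have "card {1::nat} = card {1..n}" by (rule arg_cong)
      then show False using assms(3) by simp
    qed
    then have "chain_length \<Gamma> \<noteq> 0"
    proof -
      have "nc_chains_to n (nc_one n) 0 = {}"
        using nc_chains_to_0[OF nc_one_NC, of n] assms(3) \<open>nc_one n \<noteq> nc_zero n\<close> by simp
      then show ?thesis using \<Gamma>' by (metis empty_iff)
    qed
    then show ?thesis using nc_chains_to_length_less[OF \<Gamma>'] by simp
  qed
  have fin: "finite (nc_chains n)"
  proof (rule finite_subset)
    show "nc_chains n \<subseteq> (\<Union>l\<in>{1..?N}. ?C l)" using range by blast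
    show "finite (\<Union>l\<in>{1..?N}. ?C l)" by (simp add: nc_chains_length_eq finite_nc_chains_to)
  qed
  have power: "conv_power (\<lambda>q. counit q - chi \<mu> q) l (Y w) = (-1) ^ l * (\<Sum>\<Gamma>\<in>?C l. Cf_chain w \<Gamma> ?R)" for l
    using conv_power_Y_part[OF assms(1) nc_one_NC, of w l] assms(2,3)
    by (simp add: nc_chains_length_eq Y_part_nc_one[of w, unfolded assms(2)])
  have "conv_log (chi \<mu>) (Y w) =
      - (\<Sum>l<?N. 1 / of_nat (Suc l) * conv_power (\<lambda>q. counit q - chi \<mu> q) (Suc l) (Y w))"
    unfolding conv_log_def
  proof (rule arg_cong[of _ _ uminus], rule suminf_finite)
    fix l assume "l \<notin> {..<?N}"
    then have empty: "?C (Suc l) = {}" using range by force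
    then show "1 / of_nat (Suc l) * conv_power (\<lambda>q. counit q - chi \<mu> q) (Suc l) (Y w) = 0"
      unfolding power empty by simp
  qed simp
  also have "\<dots> = (\<Sum>l<?N. \<Sum>\<Gamma>\<in>?C (Suc l). ?t \<Gamma>)"
    unfolding power sum_negf[symmetric]
    by (intro sum.cong refl) (simp add: sum_distrib_left sum_divide_distrib flip: sum_negf)
  also have "\<dots> = (\<Sum>l\<in>{1..?N}. \<Sum>\<Gamma>\<in>?C l. ?t \<Gamma>)"
    by (rule sum.reindex_bij_witness[where i = "\<lambda>l. l - 1" and j = Suc]) auto
  also have "\<dots> = (\<Sum>\<Gamma>\<in>nc_chains n. ?t \<Gamma>)"
    by (rule sum.group[OF fin]) (use range in auto)
  finally show "conv_log (chi \<mu>) (Y w) = (\<Sum>\<Gamma>\<in>nc_chains n. ?t \<Gamma>)" .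
qed

end
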